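(* Let $\Sigma_2=\{0,1\}^{\mathbb{Z}}$ with the product topology and let $\sigma:\Sigma_2\to\Sigma_2$ be the shift, $\sigma(s)_n=s_{n+1}$. Let $\mu$ be a $\sigma$-invariant ergodic Borel probability measure on $\Sigma_2$ whose support contains the periodic point $(10)^\infty$. Then for $\mu$-almost every $s\in\Sigma_2$, the set of purely periodic directions of the square tiled staircase $T_s$ is dense in $\mathbb{S}^1$.
   Context: Here $(10)^\infty$ denotes the period-two bi-infinite sequence $\cdots 101010\cdots\in\Sigma_2$. The square tiled staircase $T_s$. For $s\in\Sigma_2$, $T_s$ consists of unit squares in the plane with sides parallel to the axes, labelled by $\mathbb{Z}$: the $(n+1)$st square is placed immediately above the $n$th square if $s_n=0$, and immediately to the right of the $n$th square if $s_n=1$. Common edges of adjacent squares are identified, and pairs of boundary edges which are a horizontal or vertical translation of one another are identified by that translation: that is, for each maximal horizontal row of consecutive squares the left edge of its first square is identified with the right edge of its last square, and for each maximal vertical column of consecutive squares the bottom edge of its first square is identified with the top edge of its last square (when the row or column is finite). The result is a translation surface; the corners of the squares are its (possibly) singular points. For $\theta\in\mathbb{S}^1$ consider the unit speed straight-line flow on $T_s$ in direction $\theta$. An orbit is regular (nonsingular) if it never hits a corner in forward or backward time. A direction $\theta\in\mathbb{S}^1$ is called purely periodic for $T_s$ if all regular orbits in this direction are periodic. *)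

theory Defs
  imports "HOL-Probability.Probability"
begin

text \<open>The symbols 1 and 0 are rendered as \<^term>\<open>True\<close> and \<^term>\<open>False\<close>.  The topology on
  \<open>int \<Rightarrow> bool\<close> is the product of the discrete topologies.\<close>

type_synonym sequence2 = "int \<Rightarrow> bool"

definition shift :: "sequence2 \<Rightarrow> sequence2" where
  "shift s = (\<lambda>n. s (n + 1))"

definition shift_invariant :: "sequence2 measure \<Rightarrow> bool" where
  "shift_invariant M \<longleftrightarrow> shift \<in> measurable M M \<and> distr M M shift = M"

definition shift_ergodic :: "sequence2 measure \<Rightarrow> bool" where
  "shift_ergodic M \<longleftrightarrow> shift_invariant M \<and>
    (\<forall>A\<in>sets M. shift -` A \<inter> space M = A \<longrightarrow> emeasure M A = 0 \<or> emeasure M (space M - A) = 0)"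

definition measure_support :: "'a::topological_space measure \<Rightarrow> 'a set" where
  "measure_support M = {x. \<forall>U. open U \<and> x \<in> U \<longrightarrow> emeasure M U > 0}"

definition period_two :: sequence2 where
  "period_two = (\<lambda>n. even n)"

text \<open>A point of the disjoint union of the squares is \<open>(n, x, y)\<close>: the point of the \<open>n\<close>th square
  with coordinates \<open>(x, y)\<close> relative to the lower left corner of that square.\<close>

definition unit_square :: "(real \<times> real) set" where
  "unit_square = {0..1} \<times> {0..1}"

definition squares :: "(int \<times> real \<times> real) set" where
  "squares = UNIV \<times> unit_square"

definition maximal_row :: "sequence2 \<Rightarrow> int \<Rightarrow> int \<Rightarrow> bool" where
  "maximal_row s m n \<longleftrightarrow> m \<le> n \<and> (\<forall>k\<in>{m..<n}. s k) \<and> \<not> s (m - 1) \<and> \<not> s n"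

definition maximal_column :: "sequence2 \<Rightarrow> int \<Rightarrow> int \<Rightarrow> bool" where
  "maximal_column s m n \<longleftrightarrow> m \<le> n \<and> (\<forall>k\<in>{m..<n}. \<not> s k) \<and> s (m - 1) \<and> s n"

text \<open>An edge lying on the end of an infinite row or column remains unglued.\<close>

inductive glue :: "sequence2 \<Rightarrow> int \<times> real \<times> real \<Rightarrow> int \<times> real \<times> real \<Rightarrow> bool" for s where
  adjacent_right: "s n \<Longrightarrow> y \<in> {0..1} \<Longrightarrow> glue s (n, 1, y) (n + 1, 0, y)"
| adjacent_above: "\<not> s n \<Longrightarrow> x \<in> {0..1} \<Longrightarrow> glue s (n, x, 1) (n + 1, x, 0)"
| row_ends: "maximal_row s m n \<Longrightarrow> y \<in> {0..1} \<Longrightarrow> glue s (n, 1, y) (m, 0, y)"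
| column_ends: "maximal_column s m n \<Longrightarrow> x \<in> {0..1} \<Longrightarrow> glue s (n, x, 1) (m, x, 0)"

definition staircase_rel :: "sequence2 \<Rightarrow> ((int \<times> real \<times> real) \<times> (int \<times> real \<times> real)) set" where
  "staircase_rel s = {(p, q). p \<in> squares \<and> q \<in> squares \<and> equivclp (glue s) p q}"

lemma equiv_staircase_rel: "equiv squares (staircase_rel s)"
proof (rule equivI)
  show "refl_on squares (staircase_rel s)"
    by (auto simp: staircase_rel_def refl_on_def)
  show "sym (staircase_rel s)"
    by (auto simp: staircase_rel_def sym_def intro: equivclp_sym)
  show "trans (staircase_rel s)"
    by (auto simp: staircase_rel_def trans_def intro: equivclp_trans)
qed (auto simp: staircase_rel_def)

definition staircase :: "sequence2 \<Rightarrow> (int \<times> real \<times> real) set set" where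
  "staircase s = squares // staircase_rel s"

definition staircase_point :: "sequence2 \<Rightarrow> int \<times> real \<times> real \<Rightarrow> (int \<times> real \<times> real) set" where
  "staircase_point s p = staircase_rel s `` {p}"

definition corners :: "sequence2 \<Rightarrow> (int \<times> real \<times> real) set set" where
  "corners s = staircase_point s ` (UNIV \<times> {0, 1} \<times> {0, 1})"

text \<open>A curve on the surface is a flow line in direction \<open>\<theta>\<close> if, shortly after and shortly before
  every time \<open>t\<close>, it is a segment \<open>p + u \<theta>\<close> inside a single square.  On the interior of a glued edge
  the two segments may lie in the two squares meeting there; since the gluings are translations, this
  is straight-line motion across the edge.  A flow line is defined for all times, so one
  running into an unglued edge does not occur.\<close>

definition flow_line :: "sequence2 \<Rightarrow> real \<times> real \<Rightarrow> (real \<Rightarrow> (int \<times> real \<times> real) set) \<Rightarrow> bool" where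
  "flow_line s \<theta> \<gamma> \<longleftrightarrow> (\<forall>t.
     (\<exists>\<epsilon>>0. \<exists>n p. \<forall>u\<in>{0..\<epsilon>}. p + u *\<^sub>R \<theta> \<in> unit_square \<and>
        \<gamma> (t + u) = staircase_point s (n, p + u *\<^sub>R \<theta>)) \<and>
     (\<exists>\<epsilon>>0. \<exists>n p. \<forall>u\<in>{0..\<epsilon>}. p - u *\<^sub>R \<theta> \<in> unit_square \<and>
        \<gamma> (t - u) = staircase_point s (n, p - u *\<^sub>R \<theta>)))"

definition regular_orbit :: "sequence2 \<Rightarrow> real \<times> real \<Rightarrow> (real \<Rightarrow> (int \<times> real \<times> real) set) \<Rightarrow> bool" where
  "regular_orbit s \<theta> \<gamma> \<longleftrightarrow> flow_line s \<theta> \<gamma> \<and> (\<forall>t. \<gamma> t \<notin> corners s)"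

definition periodic_orbit :: "(real \<Rightarrow> 'a) \<Rightarrow> bool" where
  "periodic_orbit \<gamma> \<longleftrightarrow> (\<exists>T>0. \<forall>t. \<gamma> (t + T) = \<gamma> t)"

definition purely_periodic_directions :: "sequence2 \<Rightarrow> (real \<times> real) set" where
  "purely_periodic_directions s =
     {\<theta> \<in> sphere 0 1. \<forall>\<gamma>. regular_orbit s \<theta> \<gamma> \<longrightarrow> periodic_orbit \<gamma>}"

end

theory Submission
  imports Defs
begin

text \<open>Almost every \<open>s\<close> contains arbitrarily long blocks of \<open>(10)\<^sup>\<infinity>\<close> arbitrarily far to the right and to
  the left.  Fix a slope \<open>p/q\<close> in lowest terms with \<open>p + q\<close> odd.  An orbit crosses \<open>q\<close> vertical and
  \<open>p\<close> horizontal edges while its projection to the torus closes up.  In a long block of \<open>(10)\<^sup>\<infinity>\<close>, moving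
  to the horizontal or to the vertical neighbour is an involution of the squares changing the label
  by \<open>\<plusminus>1\<close>, so the \<open>p + q\<close> crossings, an odd number, compose to a reflection, and the orbit closes up after two
  turns around the torus.  Hence an orbit that reaches the middle of a block is trapped near it; since
  no row or column jumps over a block, every orbit stays in finitely many squares, returns to the
  same point of the same square, and is periodic.  These slopes are dense.\<close>

section \<open>Gluings\<close>

definition right_of :: "sequence2 \<Rightarrow> int \<Rightarrow> int \<Rightarrow> bool" where
  "right_of s n k \<longleftrightarrow> (s n \<and> k = n + 1) \<or> maximal_row s k n"

text \<open>Interchanging the two symbols reflects the staircase in the diagonal and turns columns
  into rows. With this definition every fact about rows can be reused for columns.\<close>

definition above :: "sequence2 \<Rightarrow> int \<Rightarrow> int \<Rightarrow> bool" where
  "above s = right_of (\<lambda>n. \<not> s n)"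

lemma maximal_column_eq: "maximal_column s = maximal_row (\<lambda>n. \<not> s n)"
  by (auto simp: maximal_column_def maximal_row_def fun_eq_iff)

lemma glue_iff:
  "glue s (n, x, y) (k, x', y') \<longleftrightarrow>
     x = 1 \<and> x' = 0 \<and> y' = y \<and> y \<in> {0..1} \<and> right_of s n k \<or>
     y = 1 \<and> y' = 0 \<and> x' = x \<and> x \<in> {0..1} \<and> above s n k"
  unfolding right_of_def above_def maximal_column_eq[symmetric]
  by (auto elim!: glue.cases intro: glue.intros)

lemma maximal_row_unique_start:
  assumes "maximal_row s m n" "maximal_row s m' n"
  shows "m = m'"
proof (rule ccontr)
  assume "m \<noteq> m'"
  then consider "m < m'" | "m' < m" by linarith
  then show False
    by cases (use assms in \<open>force simp: maximal_row_def\<close>)+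
qed

lemma maximal_row_unique_end:
  assumes "maximal_row s m n" "maximal_row s m n'"
  shows "n = n'"
proof (rule ccontr)
  assume "n \<noteq> n'"
  then consider "n < n'" | "n' < n" by linarith
  then show False
    by cases (use assms in \<open>force simp: maximal_row_def\<close>)+
qed

text \<open>No maximal row ends at \<open>n\<close> if \<open>s n\<close> holds, so the two ways of
  gluing a right edge exclude each other; and a maximal row is determined by its end.\<close>

lemma right_of_right_unique: "right_of s n k \<Longrightarrow> right_of s n k' \<Longrightarrow> k = k'"
  by (auto simp: right_of_def maximal_row_def dest: maximal_row_unique_start)
     (metis maximal_row_def maximal_row_unique_start)

lemma right_of_left_unique: "right_of s n k \<Longrightarrow> right_of s n' k \<Longrightarrow> n = n'"
  unfolding right_of_def
  by (auto dest: maximal_row_unique_end) (auto simp: maximal_row_def)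

lemma above_right_unique: "above s n k \<Longrightarrow> above s n k' \<Longrightarrow> k = k'"
  unfolding above_def by (rule right_of_right_unique)

lemma above_left_unique: "above s n k \<Longrightarrow> above s n' k \<Longrightarrow> n = n'"
  unfolding above_def by (rule right_of_left_unique)

fun is_corner :: "int \<times> real \<times> real \<Rightarrow> bool" where
  "is_corner (n, x, y) \<longleftrightarrow> x \<in> {0, 1} \<and> y \<in> {0, 1}"

lemma is_corner_glue: "glue s p q \<Longrightarrow> is_corner p \<longleftrightarrow> is_corner q"
  by (cases p; cases q) (auto simp: glue_iff)

lemma glue_right_unique: "glue s p q \<Longrightarrow> glue s p q' \<Longrightarrow> \<not> is_corner p \<Longrightarrow> q = q'"
  by (cases p; cases q; cases q')
     (auto simp: glue_iff dest: right_of_right_unique above_right_unique)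

lemma glue_left_unique: "glue s p q \<Longrightarrow> glue s p' q \<Longrightarrow> \<not> is_corner q \<Longrightarrow> p = p'"
  by (cases p; cases p'; cases q)
     (auto simp: glue_iff dest: right_of_left_unique above_left_unique)

text \<open>Gluings lead from a right or top edge to a left or bottom edge, so a point that is both
  a target and a source has one coordinate 0 and the other 1.\<close>

lemma glue_not_chained: "glue s p q \<Longrightarrow> glue s q r \<Longrightarrow> is_corner q"
  by (cases p; cases q; cases r) (auto simp: glue_iff)

text \<open>Away from corners \<open>glue s\<close> is a partial injection in which no target is
  again a source, so the equivalence it generates has classes of at most two points.\<close>

lemma equivclp_glue_noncorner:
  assumes "equivclp (glue s) p q" "\<not> is_corner p"
  shows "\<not> is_corner q \<and> (p = q \<or> glue s p q \<or> glue s q p)"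
  using assms(1)
proof (induction rule: equivclp_induct)
  case base
  then show ?case using assms(2) by simp
next
  case (step q r)
  then show ?case
    using is_corner_glue glue_right_unique glue_left_unique glue_not_chained by metis
qed

lemma staircase_point_eq_cases:
  assumes "staircase_point s p = staircase_point s q" "p \<in> squares" "q \<in> squares"
    and "\<not> is_corner p"
  shows "p = q \<or> glue s p q \<or> glue s q p"
proof -
  have "(p, q) \<in> staircase_rel s"
    using assms(1-3) eq_equiv_class[OF _ equiv_staircase_rel] unfolding staircase_point_def by metis
  then show ?thesis
    using equivclp_glue_noncorner[OF _ assms(4)] by (auto simp: staircase_rel_def)
qed

lemma staircase_point_corner:
  assumes "is_corner p"
  shows "staircase_point s p \<in> corners s"
  using assms by (cases p) (auto simp: corners_def)

section \<open>Alternating blocks\<close>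

text \<open>Symmetric, because the signs of the components of the direction decide which way an edge
  is crossed.\<close>

definition adjacent :: "(int \<Rightarrow> int \<Rightarrow> bool) \<Rightarrow> int \<Rightarrow> int \<Rightarrow> bool" where
  "adjacent R n k \<longleftrightarrow> R n k \<or> R k n"

text \<open>A window of the period-two point, normalised so that its centre \<open>c\<close> carries
  the symbol 1 (for \<open>r \<ge> 0\<close>).\<close>

definition alternating :: "sequence2 \<Rightarrow> int \<Rightarrow> int \<Rightarrow> bool" where
  "alternating s c r \<longleftrightarrow> (\<forall>n. \<bar>n - c\<bar> \<le> r \<longrightarrow> (s n \<longleftrightarrow> even (n - c)))"

lemma alternating_complement:
  "alternating s c r \<Longrightarrow> alternating (\<lambda>n. \<not> s n) (c + 1) (r - 1)"
  unfolding alternating_def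
proof (intro allI impI)
  fix n
  assume *: "\<forall>n. \<bar>n - c\<bar> \<le> r \<longrightarrow> s n = even (n - c)" and "\<bar>n - (c + 1)\<bar> \<le> r - 1"
  then have "s n = even (n - c)" by auto
  then show "(\<not> s n) = even (n - (c + 1))" by auto
qed

text \<open>Inside the block every row consists of two squares, \<open>n\<close> and
  \<open>n + 1\<close> with \<open>n - c\<close> even. Each is both the left and the right neighbour
  of the other: one way by adjacency, the other way by the gluing of the row ends.\<close>

lemma adjacent_right_of_alternating:
  assumes "alternating s c r" "\<bar>n - c\<bar> \<le> r - 2" "adjacent (right_of s) n k"
  shows "k = n + (if even (n - c) then 1 else - 1)"
proof -
  have s: "s j \<longleftrightarrow> even (j - c)" if "\<bar>j - n\<bar> \<le> 2" for j
    using assms(1,2) that unfolding alternating_def by force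
  have s': "s n \<longleftrightarrow> even (n - c)" "s (n + 1) \<longleftrightarrow> odd (n - c)" "s (n - 1) \<longleftrightarrow> odd (n - c)"
    "s (n - 2) \<longleftrightarrow> even (n - c)"
    using s[of n] s[of "n + 1"] s[of "n - 1"] s[of "n - 2"] by auto
  consider "s n" "k = n + 1" | "s k" "n = k + 1" | "maximal_row s k n" | "maximal_row s n k"
    using assms(3) unfolding adjacent_def right_of_def by blast
  then show ?thesis
  proof cases
    case 3
    then have "\<not> s n" "\<not> s (k - 1)" "k \<le> n" and row: "\<And>j. k \<le> j \<Longrightarrow> j < n \<Longrightarrow> s j"
      by (auto simp: maximal_row_def)
    moreover have "\<not> k \<le> n - 2" using row[of "n - 2"] s' \<open>\<not> s n\<close> by auto
    moreover have "k \<noteq> n" using s' \<open>\<not> s n\<close> \<open>\<not> s (k - 1)\<close> by auto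
    ultimately show ?thesis using s' by auto
  next
    case 4
    then have "\<not> s k" "\<not> s (n - 1)" "n \<le> k" and row: "\<And>j. n \<le> j \<Longrightarrow> j < k \<Longrightarrow> s j"
      by (auto simp: maximal_row_def)
    moreover have "\<not> k \<ge> n + 2" using row[of "n + 1"] s' \<open>\<not> s (n - 1)\<close> by auto
    moreover have "k \<noteq> n" using s' \<open>\<not> s k\<close> \<open>\<not> s (n - 1)\<close> by auto
    ultimately show ?thesis using s' by auto
  qed (use s' in auto)
qed

text \<open>This is the row case for the complemented sequence, whose block has centre
  \<open>c + 1\<close> and radius \<open>r - 1\<close>. Each of these two changes costs one more
  unit of margin, hence \<open>r - 4\<close>.\<close>

lemma adjacent_above_alternating:
  assumes "alternating s c r" "\<bar>n - c\<bar> \<le> r - 4" "adjacent (above s) n k"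
  shows "k = n - (if even (n - c) then 1 else - 1)"
proof -
  have "k = n + (if even (n - (c + 1)) then 1 else - 1)"
    using adjacent_right_of_alternating[OF alternating_complement[OF assms(1)], of n k] assms(2,3)
    unfolding above_def by linarith
  then show ?thesis by auto
qed

text \<open>A row with squares on both sides of \<open>c\<close> would make two consecutive steps to
  the right, at \<open>c - 1\<close> and at \<open>c\<close>.\<close>

lemma not_right_of_across:
  assumes "\<not> (s (c - 1) \<and> s c)" "n < c" "c < k"
  shows "\<not> adjacent (right_of s) n k"
  using assms unfolding adjacent_def right_of_def maximal_row_def by auto

text \<open>At the centre of a block \<open>s (c - 1)\<close> and \<open>s c\<close> differ, so
  neither a row nor a column extends to both sides of \<open>c\<close>: a path can pass the centre
  only by visiting it.\<close>

lemma adjacent_not_across: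
  assumes "alternating s c r" "r \<ge> 1" "adjacent (right_of s) n k \<or> adjacent (above s) n k"
  shows "\<not> (n < c \<and> c < k)" "\<not> (k < c \<and> c < n)"
proof -
  have "s c" "\<not> s (c - 1)" using assms(1,2) unfolding alternating_def by auto
  then have *: "\<not> (n < c \<and> c < k)" if "adjacent (right_of s) n k \<or> adjacent (above s) n k" for n k
    using that not_right_of_across[of s c n k] not_right_of_across[of "\<lambda>n. \<not> s n" c n k]
    unfolding above_def by blast
  show "\<not> (n < c \<and> c < k)" using * assms(3) by blast
  show "\<not> (k < c \<and> c < n)" using *[of k n] assms(3) unfolding adjacent_def by blast
qed

section \<open>Walks on the squares along a line of rational slope\<close>

lemma div_add_one: "(m + 1) div d = m div d + of_bool (d dvd m + 1)" if "d > 0" for m d :: int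
proof (cases "d dvd m + 1")
  case True
  then obtain q where q: "m + 1 = d * q" by (auto elim: dvdE)
  then have "m div d = q - 1"
    using that by (intro int_div_pos_eq[where r = "d - 1"]) (auto simp: algebra_simps)
  then show ?thesis using q that by simp
next
  case False
  have r: "0 \<le> m mod d" "m mod d < d" using that by auto
  have "m mod d + 1 \<noteq> d"
  proof
    assume "m mod d + 1 = d"
    moreover have "m = d * (m div d) + m mod d" by simp
    ultimately have "m + 1 = d * (m div d + 1)" unfolding distrib_left by linarith
    then show False using False by (metis dvd_triv_left)
  qed
  then have "(m + 1) div d = m div d"
    using r mult_div_mod_eq[of d m]
    by (intro int_div_pos_eq[where r = "m mod d + 1"]) (auto simp: algebra_simps)
  then show ?thesis using False by simp
qed

text \<open>The successive squares \<open>N k\<close> visited by an orbit of slope \<open>\<plusminus>P/Q\<close>, sampled so finely that each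
  step crosses at most one edge: a vertical one if \<open>2 P\<close> divides \<open>i0 + k\<close> and a horizontal one if
  \<open>2 Q\<close> divides \<open>j0 + k\<close>.\<close>

locale square_path =
  fixes s :: sequence2 and P Q i0 j0 :: int and N :: "nat \<Rightarrow> int"
  assumes P_pos: "P > 0" and Q_pos: "Q > 0" and odd_PQ: "odd (P + Q)" and odd_ij: "odd (i0 + j0)"
    and step_right: "2 * P dvd i0 + int k \<Longrightarrow> adjacent (right_of s) (N k) (N (Suc k))"
    and step_above: "2 * Q dvd j0 + int k \<Longrightarrow> adjacent (above s) (N k) (N (Suc k))"
    and step_same: "\<not> 2 * P dvd i0 + int k \<Longrightarrow> \<not> 2 * Q dvd j0 + int k \<Longrightarrow> N (Suc k) = N k"
begin

text \<open>Up to an additive constant, the number of edges crossed in the first \<open>k\<close>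
  steps: the quotients count the multiples of \<open>2 * P\<close> and of \<open>2 * Q\<close> that
  have been passed.\<close>

definition crossings :: "nat \<Rightarrow> int" where
  "crossings k = (i0 - 1 + int k) div (2 * P) + (j0 - 1 + int k) div (2 * Q)"

text \<open>A common multiple of \<open>2 * P\<close> and \<open>2 * Q\<close>, so the pattern of
  steps repeats. It contains \<open>Q\<close> vertical and \<open>P\<close> horizontal
  crossings.\<close>

definition period :: nat where "period = nat (2 * P * Q)"

lemma int_period: "int period = 2 * P * Q"
  using P_pos Q_pos by (simp add: period_def)

lemma period_pos: "period > 0"
  using P_pos Q_pos by (simp add: period_def)

lemma crossings_Suc:
  "crossings (Suc k) = crossings k + of_bool (2 * P dvd i0 + int k) + of_bool (2 * Q dvd j0 + int k)"
  using div_add_one[of "2 * P" "i0 - 1 + int k"] div_add_one[of "2 * Q" "j0 - 1 + int k"] P_pos Q_pos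
  by (simp add: crossings_def algebra_simps)

lemma crossings_period: "crossings (k + period) = crossings k + (P + Q)"
proof -
  have "(i0 - 1 + int (k + period)) div (2 * P) = (i0 - 1 + int k) div (2 * P) + Q"
    using div_mult_self1[of "2 * P" "i0 - 1 + int k" Q] P_pos
    by (simp add: int_period algebra_simps)
  moreover have "(j0 - 1 + int (k + period)) div (2 * Q) = (j0 - 1 + int k) div (2 * Q) + P"
    using div_mult_self1[of "2 * Q" "j0 - 1 + int k" P] Q_pos
    by (simp add: int_period algebra_simps)
  ultimately show ?thesis by (simp add: crossings_def)
qed

lemma not_both: "\<not> (2 * P dvd i0 + int k \<and> 2 * Q dvd j0 + int k)"
proof
  assume "2 * P dvd i0 + int k \<and> 2 * Q dvd j0 + int k"
  then have "even (i0 + int k)" "even (j0 + int k)" using dvd_mult_left by blast+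
  then show False using odd_ij by presburger
qed

text \<open>The change of label in a block when the offset from the centre is even: a vertical edge
  raises the label and a horizontal one lowers it. At odd offsets the sign is reversed.\<close>

definition drift :: "nat \<Rightarrow> int" where
  "drift k = of_bool (2 * P dvd i0 + int k) - of_bool (2 * Q dvd j0 + int k)"

lemma drift_period: "drift (k + period) = drift k"
proof -
  have "2 * P dvd i0 + int (k + period) \<longleftrightarrow> 2 * P dvd i0 + int k"
    using dvd_add_times_triv_right_iff[of "2 * P" "i0 + int k" Q]
    by (simp add: int_period algebra_simps)
  moreover have "2 * Q dvd j0 + int (k + period) \<longleftrightarrow> 2 * Q dvd j0 + int k"
    using dvd_add_times_triv_right_iff[of "2 * Q" "j0 + int k" P]
    by (simp add: int_period algebra_simps)
  ultimately show ?thesis by (simp add: drift_def)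
qed

lemma drift_cases: "drift k \<in> {- 1, 0, 1}"
  using not_both[of k] by (auto simp: drift_def)

lemma crossings_Suc_drift: "even (crossings (Suc k)) \<longleftrightarrow> even (crossings k + drift k)"
  by (simp add: crossings_Suc drift_def)

lemma step_alternating:
  assumes "alternating s c r" "\<bar>N k - c\<bar> \<le> r - 4"
  shows "N (Suc k) = N k + (if even (N k - c) then drift k else - drift k)"
  using step_right[of k] step_above[of k] step_same[of k] not_both[of k] assms
    adjacent_right_of_alternating[of s c r "N k" "N (Suc k)"]
    adjacent_above_alternating[of s c r "N k" "N (Suc k)"]
  unfolding drift_def by auto

context
  fixes c k0
  assumes alt: "alternating s c (2 * int period + 4)" and start: "N k0 = c"
begin

text \<open>A step changes the label by at most one, and changes its parity exactly when an edge is
  crossed. The radius of the block covers two periods of steps plus the margin 4 of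
  \<open>step_alternating\<close>.\<close>

lemma stays_close:
  "j \<le> 2 * period \<Longrightarrow> \<bar>N (k0 + j) - c\<bar> \<le> int j \<and>
     (even (N (k0 + j) - c) \<longleftrightarrow> even (crossings (k0 + j) - crossings k0))"
proof (induction j)
  case 0
  then show ?case using start by simp
next
  case (Suc j)
  then have IH: "\<bar>N (k0 + j) - c\<bar> \<le> int j"
    "even (N (k0 + j) - c) \<longleftrightarrow> even (crossings (k0 + j) - crossings k0)" by auto
  then have "N (Suc (k0 + j)) =
      N (k0 + j) + (if even (N (k0 + j) - c) then drift (k0 + j) else - drift (k0 + j))"
    using Suc.prems by (intro step_alternating[OF alt]) auto
  then show ?case
    using IH drift_cases[of "k0 + j"] crossings_Suc_drift[of "k0 + j"] by auto
qed

text \<open>Squares visited one period apart have opposite parity, as \<open>P + Q\<close> is odd; hence their steps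
  cancel and their labels have a constant sum.\<close>

lemma sum_conserved: "j \<le> period \<Longrightarrow> N (k0 + j) + N (k0 + j + period) = c + N (k0 + period)"
proof (induction j)
  case 0
  then show ?case using start by simp
next
  case (Suc j)
  have close: "\<bar>N (k0 + j) - c\<bar> \<le> 2 * int period" "\<bar>N (k0 + j + period) - c\<bar> \<le> 2 * int period"
    using stays_close[of j] stays_close[of "j + period"] Suc.prems by (auto simp: add.assoc)
  have "even (N (k0 + j) - c) \<longleftrightarrow> odd (N (k0 + j + period) - c)"
    using stays_close[of j] stays_close[of "j + period"] Suc.prems crossings_period[of "k0 + j"] odd_PQ
    by (auto simp: add.assoc)
  moreover have "N (Suc (k0 + j)) =
      N (k0 + j) + (if even (N (k0 + j) - c) then drift (k0 + j) else - drift (k0 + j))"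
    using close by (intro step_alternating[OF alt]) auto
  moreover have "N (Suc (k0 + j + period)) = N (k0 + j + period) +
      (if even (N (k0 + j + period) - c) then drift (k0 + j) else - drift (k0 + j))"
    using close step_alternating[OF alt, of "k0 + j + period"] drift_period[of "k0 + j"] by auto
  ultimately show ?case using Suc by auto
qed

text \<open>For \<open>j = period\<close> the term \<open>N (k0 + period)\<close> stands on both
  sides of the conserved sum and cancels.\<close>

lemma returns: "N (k0 + 2 * period) = c"
  using sum_conserved[of period] by (simp add: mult_2 add.assoc)

end

lemma stays_close_forever:
  assumes alt: "alternating s c (2 * int period + 4)" and "N k0 = c"
  shows "\<bar>N (k0 + j) - c\<bar> \<le> 2 * int period"
proof -
  have ret: "N (k0 + 2 * period * i) = c" for i
  proof (induction i)
    case 0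
    then show ?case using assms by simp
  next
    case (Suc i)
    then show ?case using returns[OF alt Suc] by (simp add: algebra_simps)
  qed
  define i r where "i = j div (2 * period)" and "r = j mod (2 * period)"
  have "r < 2 * period" "j = 2 * period * i + r"
    using period_pos by (auto simp: i_def r_def)
  then show ?thesis
    using stays_close[OF alt ret[of i], of r] by (simp add: add.assoc)
qed

lemma adjacent_steps:
  "N (Suc k) = N k \<or> adjacent (right_of s) (N k) (N (Suc k)) \<or> adjacent (above s) (N k) (N (Suc k))"
  using step_right step_above step_same by blast

text \<open>Choose block centres \<open>a\<close> and \<open>b\<close> on either side of
  \<open>N 0\<close>. Until the path visits one of them it stays strictly between, since no step
  jumps over a centre; after such a visit it stays within two periods of that centre.\<close>

lemma finite_range:
  assumes right: "\<And>m r. \<exists>c\<ge>m. alternating s c r" and left: "\<And>m r. \<exists>c\<le>m. alternating s c r"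
  shows "finite (range N)"
proof -
  define r where "r = 2 * int period + 4"
  obtain a where a: "a \<le> N 0 - 1" "alternating s a r" using left by blast
  obtain b where b: "b \<ge> N 0 + 1" "alternating s b r" using right by blast
  have "r \<ge> 1" by (simp add: r_def)
  have close: "\<bar>N (k0 + j) - N k0\<bar> \<le> 2 * int period" if "N k0 \<in> {a, b}" for k0 j
    using that a b stays_close_forever unfolding r_def by auto
  have "a - 2 * int period \<le> N k \<and> N k \<le> b + 2 * int period" for k
  proof (cases "\<exists>k0\<le>k. N k0 \<in> {a, b}")
    case True
    then obtain k0 where "k0 \<le> k" "N k0 \<in> {a, b}" by blast
    then show ?thesis using close[of k0 "k - k0"] a b by auto
  next
    case False
    then have "k' \<le> k \<Longrightarrow> a < N k' \<and> N k' < b" for k'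
    proof (induction k')
      case 0
      then show ?case using a b by simp
    next
      case (Suc k')
      then have "a < N k'" "N k' < b" "N (Suc k') \<noteq> a" "N (Suc k') \<noteq> b" by auto
      then show ?case
        using adjacent_steps[of k'] adjacent_not_across[OF a(2) \<open>r \<ge> 1\<close>, of "N k'" "N (Suc k')"]
          adjacent_not_across[OF b(2) \<open>r \<ge> 1\<close>, of "N k'" "N (Suc k')"] by force
    qed
    then have "a < N k" "N k < b" by auto
    then show ?thesis by simp
  qed
  then have "range N \<subseteq> {a - 2 * int period..b + 2 * int period}" by auto
  then show ?thesis by (rule finite_subset) simp
qed

text \<open>Pigeonhole, applied only to multiples of \<open>period\<close>, because at these times
  the orbit also has the same position on the torus.\<close>

lemma recurs:
  assumes "\<And>m r. \<exists>c\<ge>m. alternating s c r" and "\<And>m r. \<exists>c\<le>m. alternating s c r"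
  obtains i j where "i < j" "N (period * i) = N (period * j)"
proof -
  have "finite (range (\<lambda>i. N (period * i)))"
    by (rule finite_subset[OF _ finite_range[OF assms]]) auto
  then have "\<not> inj (\<lambda>i. N (period * i))"
    using finite_imageD by blast
  then obtain i j where "i \<noteq> j" "N (period * i) = N (period * j)"
    by (auto simp: inj_on_def)
  then show ?thesis using that by (cases i j rule: linorder_cases) auto
qed

end

section \<open>Recurrence of alternating blocks for almost every sequence\<close>

lemma open_alternating: "open {s. alternating s c r}"
proof -
  have "open {s::sequence2. s n = b}" for n b
  proof -
    have "{s::sequence2. s n = b} = (\<lambda>s. s n) -` {b}" by auto
    moreover have "open ((\<lambda>s::sequence2. s n) -` {b})"
      by (rule open_vimage[OF Topological_Spaces.open_discrete continuous_on_product_coordinates])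
    ultimately show ?thesis by simp
  qed
  \<comment> \<open>Only finitely many coordinates are constrained, so the set is a finite
    intersection of open cylinders.\<close>
  moreover have "\<bar>n - c\<bar> \<le> r \<longleftrightarrow> n \<in> {c - r..c + r}" for n
    by auto
  then have "{s. alternating s c r} = (\<Inter>n\<in>{c - r..c + r}. {s. s n = even (n - c)})"
    unfolding alternating_def by blast
  ultimately show ?thesis by (simp add: open_INT)
qed

lemma alternating_shift: "alternating (shift s) c r \<longleftrightarrow> alternating s (c + 1) r"
proof
  assume *: "alternating (shift s) c r"
  show "alternating s (c + 1) r"
    unfolding alternating_def
  proof (intro allI impI)
    fix n assume "\<bar>n - (c + 1)\<bar> \<le> r"
    then have "\<bar>(n - 1) - c\<bar> \<le> r" by simp
    then have "shift s (n - 1) \<longleftrightarrow> even ((n - 1) - c)" using * unfolding alternating_def by blast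
    then show "s n = even (n - (c + 1))" by (simp add: shift_def algebra_simps)
  qed
next
  assume *: "alternating s (c + 1) r"
  show "alternating (shift s) c r"
    unfolding alternating_def
  proof (intro allI impI)
    fix n assume "\<bar>n - c\<bar> \<le> r"
    then have "\<bar>(n + 1) - (c + 1)\<bar> \<le> r" by simp
    then have "s (n + 1) \<longleftrightarrow> even ((n + 1) - (c + 1))" using * unfolding alternating_def by blast
    then show "shift s n = even (n - c)" by (simp add: shift_def)
  qed
qed

lemma ex_ge_add_one: "(\<exists>c\<ge>a. Q (c + 1)) \<longleftrightarrow> (\<exists>c\<ge>a + 1. Q c)" for a :: int
proof
  assume "\<exists>c\<ge>a + 1. Q c"
  then obtain c where "c \<ge> a + 1" "Q c" by blast
  then show "\<exists>c\<ge>a. Q (c + 1)" by (intro exI[of _ "c - 1"]) auto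
next
  assume "\<exists>c\<ge>a. Q (c + 1)"
  then obtain c where "c \<ge> a" "Q (c + 1)" by blast
  then show "\<exists>c\<ge>a + 1. Q c" by (intro exI[of _ "c + 1"]) auto
qed

lemma ex_le_add_one: "(\<exists>c\<le>a. Q (c + 1)) \<longleftrightarrow> (\<exists>c\<le>a + 1. Q c)" for a :: int
proof
  assume "\<exists>c\<le>a + 1. Q c"
  then obtain c where "c \<le> a + 1" "Q c" by blast
  then show "\<exists>c\<le>a. Q (c + 1)" by (intro exI[of _ "c - 1"]) auto
next
  assume "\<exists>c\<le>a. Q (c + 1)"
  then obtain c where "c \<le> a" "Q (c + 1)" by blast
  then show "\<exists>c\<le>a + 1. Q c" by (intro exI[of _ "c + 1"]) auto
qed

text \<open>By continuity from above the intersection has the common measure of the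
  \<open>F i\<close>, which is positive. Being invariant, it has full measure by ergodicity.\<close>

lemma ergodic_AE_Inter:
  assumes "prob_space \<mu>" "space \<mu> = UNIV" "shift_ergodic \<mu>"
    and meas: "\<And>i::nat. F i \<in> sets \<mu>" and "decseq F"
    and inv: "shift -` (\<Inter>i. F i) = (\<Inter>i. F i)"
    and const: "\<And>i. emeasure \<mu> (F i) = emeasure \<mu> (F 0)" and pos: "emeasure \<mu> (F 0) > 0"
  shows "AE s in \<mu>. s \<in> (\<Inter>i. F i)"
proof -
  interpret prob_space \<mu> by fact
  have Int: "(\<Inter>i. F i) \<in> sets \<mu>" using meas by auto
  have "emeasure \<mu> (\<Inter>i. F i) = (INF i. emeasure \<mu> (F i))"
    using meas \<open>decseq F\<close> by (intro INF_emeasure_decseq[symmetric]) auto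
  also have "\<dots> = emeasure \<mu> (F 0)" by (subst const) simp
  finally have "emeasure \<mu> (\<Inter>i. F i) \<noteq> 0" using pos by simp
  then have "emeasure \<mu> (space \<mu> - (\<Inter>i. F i)) = 0"
    using assms(2,3) Int inv unfolding shift_ergodic_def by auto
  then have "space \<mu> - (\<Inter>i. F i) \<in> null_sets \<mu>" using Int by auto
  then show ?thesis by (rule AE_I'[where N = "space \<mu> - (\<Inter>i. F i)"]) auto
qed

text \<open>Blocks centred at or beyond \<open>i\<close> form a decreasing sequence of sets that the
  shift permutes by one index, so all have the same measure. It is positive because blocks centred
  at 0 form an open neighbourhood of \<open>period_two\<close>.\<close>

lemma AE_alternating:
  assumes "prob_space \<mu>" "sets \<mu> = sets borel" "shift_ergodic \<mu>" "period_two \<in> measure_support \<mu>"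
  shows "AE s in \<mu>. \<forall>m r. (\<exists>c\<ge>m. alternating s c r) \<and> (\<exists>c\<le>m. alternating s c r)"
proof -
  have sp: "space \<mu> = UNIV" using sets_eq_imp_space_eq[OF assms(2)] by simp
  have inv: "shift \<in> measurable \<mu> \<mu>" "distr \<mu> \<mu> shift = \<mu>"
    using assms(3) by (auto simp: shift_ergodic_def shift_invariant_def)
  have em: "emeasure \<mu> (shift -` A) = emeasure \<mu> A" if "A \<in> sets \<mu>" for A
    using emeasure_distr[OF inv(1) that] inv(2) sp by simp
  have pos: "emeasure \<mu> A > 0" if "{s. alternating s 0 r} \<subseteq> A" "A \<in> sets \<mu>" for A r
  proof -
    have "period_two \<in> {s. alternating s 0 r}" by (auto simp: alternating_def period_two_def)
    then have "emeasure \<mu> {s. alternating s 0 r} > 0"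
      using assms(4) open_alternating unfolding measure_support_def by blast
    then show ?thesis using emeasure_mono[OF that] by (rule less_le_trans)
  qed
  have meas: "{s. \<exists>c. p c \<and> alternating s c r} \<in> sets \<mu>" for p r
  proof -
    have "{s. \<exists>c. p c \<and> alternating s c r} = (\<Union>c\<in>{c. p c}. {s. alternating s c r})" by auto
    then show ?thesis using open_alternating assms(2) by (auto intro!: borel_open open_UN)
  qed
  have "AE s in \<mu>. \<forall>i::nat. \<exists>c\<ge>int i. alternating s c r" for r
  proof -
    define F where "F i = {s. \<exists>c\<ge>int i. alternating s c r}" for i
    have F: "F i \<in> sets \<mu>" for i unfolding F_def by (rule meas)
    have Suc: "shift -` F i = F (Suc i)" for i
    proof -
      have "(\<exists>c\<ge>int i. alternating s (c + 1) r) \<longleftrightarrow> (\<exists>c\<ge>int (Suc i). alternating s c r)" for s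
        using ex_ge_add_one[of "int i" "\<lambda>c. alternating s c r"] by (simp add: add.commute)
      then show ?thesis unfolding F_def by (auto simp: alternating_shift)
    qed
    have "decseq F" unfolding F_def by (intro decseq_SucI Collect_mono) (smt (verit) of_nat_Suc)
    have "AE s in \<mu>. s \<in> (\<Inter>i. F i)"
    proof (rule ergodic_AE_Inter[OF assms(1) sp assms(3) F \<open>decseq F\<close>])
      have "shift s \<in> F i \<longleftrightarrow> s \<in> F (Suc i)" for s i
        using Suc by auto
      moreover have "F (Suc i) \<subseteq> F i" for i
        using \<open>decseq F\<close> by (rule decseq_SucD)
      ultimately show "shift -` (\<Inter>i. F i) = (\<Inter>i. F i)" by blast
      show "emeasure \<mu> (F i) = emeasure \<mu> (F 0)" for i
      proof (induction i)
        case (Suc i)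
        then show ?case using em[OF F[of i]] \<open>\<And>i. shift -` F i = F (Suc i)\<close> by metis
      qed simp
      show "emeasure \<mu> (F 0) > 0"
        by (rule pos[OF _ F, of r]) (auto simp: F_def)
    qed
    then show ?thesis by (simp add: F_def)
  qed
  moreover have "AE s in \<mu>. \<forall>i::nat. \<exists>c\<le>- int i. alternating s c r" for r
  proof -
    define F where "F i = {s. \<exists>c\<le>- int i. alternating s c r}" for i
    have F: "F i \<in> sets \<mu>" for i unfolding F_def by (rule meas)
    \<comment> \<open>To the left the index moves the other way: the preimage of the smaller set is
      the larger one.\<close>
    have Suc: "shift -` F (Suc i) = F i" for i
    proof -
      have "(\<exists>c\<le>- int (Suc i). alternating s (c + 1) r) \<longleftrightarrow> (\<exists>c\<le>- int i. alternating s c r)" for s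
        using ex_le_add_one[of "- int (Suc i)" "\<lambda>c. alternating s c r"] by simp
      then show ?thesis unfolding F_def by (auto simp: alternating_shift)
    qed
    have dec: "decseq F" unfolding F_def by (intro decseq_SucI Collect_mono) (smt (verit) of_nat_Suc)
    have "AE s in \<mu>. s \<in> (\<Inter>i. F i)"
    proof (rule ergodic_AE_Inter[OF assms(1) sp assms(3) F dec])
      have "shift s \<in> F (Suc i) \<longleftrightarrow> s \<in> F i" for s i
        using Suc by auto
      moreover have "F (Suc i) \<subseteq> F i" for i
        using dec by (rule decseq_SucD)
      ultimately show "shift -` (\<Inter>i. F i) = (\<Inter>i. F i)" by blast
      show "emeasure \<mu> (F i) = emeasure \<mu> (F 0)" for i
      proof (induction i)
        case (Suc i)
        then show ?case using em[OF F[of "Suc i"]] \<open>\<And>i. shift -` F (Suc i) = F i\<close> by metis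
      qed simp
      show "emeasure \<mu> (F 0) > 0"
        by (rule pos[OF _ F, of r]) (auto simp: F_def)
    qed
    then show ?thesis by (simp add: F_def)
  qed
  ultimately have "\<forall>r. AE s in \<mu>. (\<forall>i::nat. \<exists>c\<ge>int i. alternating s c r) \<and>
      (\<forall>i::nat. \<exists>c\<le>- int i. alternating s c r)"
    by (intro allI AE_conjI)
  \<comment> \<open>The radii are integers, so countably many null sets are discarded.\<close>
  then have "AE s in \<mu>. \<forall>r. (\<forall>i::nat. \<exists>c\<ge>int i. alternating s c r) \<and>
      (\<forall>i::nat. \<exists>c\<le>- int i. alternating s c r)"
    by (subst AE_all_countable)
  then show ?thesis
  proof eventually_elim
    case (elim s)
    show ?case
    proof (intro allI)
      fix m r :: int
      from elim obtain c c' where c: "c \<ge> int (nat \<bar>m\<bar>)" "alternating s c r"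
        "c' \<le> - int (nat \<bar>m\<bar>)" "alternating s c' r" by blast
      then have "c \<ge> m" "c' \<le> m" by linarith+
      then show "(\<exists>c\<ge>m. alternating s c r) \<and> (\<exists>c\<le>m. alternating s c r)" using c by blast
    qed
  qed
qed

section \<open>Flow lines\<close>

text \<open>Flow lines are described by separate segments after and before each time, so local
  constancy is checked on each side separately.\<close>

lemma connected_local_const_sides:
  fixes f :: "real \<Rightarrow> 'b"
  assumes "connected A" "a \<in> A" "b \<in> A"
    and right: "\<And>t. t \<in> A \<Longrightarrow> \<exists>\<epsilon>>0. \<forall>u\<in>{0<..<\<epsilon>}. t + u \<in> A \<longrightarrow> f (t + u) = f t"
    and left: "\<And>t. t \<in> A \<Longrightarrow> \<exists>\<epsilon>>0. \<forall>u\<in>{0<..<\<epsilon>}. t - u \<in> A \<longrightarrow> f (t - u) = f t"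
  shows "f a = f b"
proof (rule connected_local_const[OF assms(1-3)], intro ballI)
  fix t assume "t \<in> A"
  obtain \<epsilon> where \<epsilon>: "\<epsilon> > 0" "\<And>u. 0 < u \<Longrightarrow> u < \<epsilon> \<Longrightarrow> t + u \<in> A \<Longrightarrow> f (t + u) = f t"
    using right[OF \<open>t \<in> A\<close>] by auto
  obtain \<delta> where \<delta>: "\<delta> > 0" "\<And>u. 0 < u \<Longrightarrow> u < \<delta> \<Longrightarrow> t - u \<in> A \<Longrightarrow> f (t - u) = f t"
    using left[OF \<open>t \<in> A\<close>] by auto
  have "f t = f t'" if "t' \<in> A" "t' \<noteq> t" "dist t' t < min \<epsilon> \<delta>" for t'
    using that \<epsilon>(2)[of "t' - t"] \<delta>(2)[of "t - t'"] by (cases "t < t'") (auto simp: dist_real_def)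
  then show "eventually (\<lambda>b. f t = f b) (at t within A)"
    unfolding eventually_at using \<epsilon>(1) \<delta>(1) by (intro exI[of _ "min \<epsilon> \<delta>"]) auto
qed

lemma Ints_diff_unit: "x - y \<in> \<int> \<Longrightarrow> x \<in> {0..1} \<Longrightarrow> y \<in> {0<..<1} \<Longrightarrow> x = y" for x y :: real
proof -
  assume *: "x - y \<in> \<int>" "x \<in> {0..1}" "y \<in> {0<..<1}"
  then obtain k where k: "x - y = of_int k" by (auto elim: Ints_cases)
  then have "- 1 < real_of_int k" "real_of_int k < 1" using * by auto
  then have "k = 0" by linarith
  then show "x = y" using k by simp
qed

lemma interior_of_ends:
  assumes "z \<in> {0..1}" "z + e * a \<in> {0..1}" "a \<noteq> 0" "u \<in> {0<..<e}"
  shows "z + u * a \<in> {0<..<1::real}"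
proof (cases "a > 0")
  case True
  then have "0 < u * a" "u * a < e * a" using assms(4) by auto
  then show ?thesis using assms by auto
next
  case False
  then have "a < 0" using assms(3) by simp
  then have "u * a < 0" "e * a < u * a" using assms(4) by (auto simp: mult_pos_neg)
  then show ?thesis using assms by auto
qed

definition curve_at :: "(real \<Rightarrow> (int \<times> real \<times> real) set) \<Rightarrow> sequence2 \<Rightarrow> real \<Rightarrow>
    int \<times> real \<times> real \<Rightarrow> bool" where
  "curve_at \<gamma> s t p \<longleftrightarrow> p \<in> squares \<and> \<gamma> t = staircase_point s p"

lemma curve_at_unit: "curve_at \<gamma> s t (n, x, y) \<Longrightarrow> x \<in> {0..1} \<and> y \<in> {0..1}"
  by (auto simp: curve_at_def squares_def unit_square_def)

locale regular_flow =
  fixes s :: sequence2 and \<alpha> \<beta> :: real and \<gamma> :: "real \<Rightarrow> (int \<times> real \<times> real) set"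
  assumes \<alpha>_nz: "\<alpha> \<noteq> 0" and \<beta>_nz: "\<beta> \<noteq> 0" and regular: "regular_orbit s (\<alpha>, \<beta>) \<gamma>"
begin

abbreviation at_point :: "real \<Rightarrow> int \<times> real \<times> real \<Rightarrow> bool" where
  "at_point \<equiv> curve_at \<gamma> s"

text \<open>Time reversal exchanges the two halves of the definition of a flow line; facts about the
  past thus follow from facts about the future.\<close>

lemma reversed: "regular_flow s (- \<alpha>) (- \<beta>) (\<lambda>t. \<gamma> (- t))"
proof
  have "flow_line s (\<alpha>, \<beta>) \<gamma>" using regular by (simp add: regular_orbit_def)
  then have 1: "\<exists>\<epsilon>>0. \<exists>n p. \<forall>u\<in>{0..\<epsilon>}. p + u *\<^sub>R (\<alpha>, \<beta>) \<in> unit_square \<and>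
        \<gamma> (- t + u) = staircase_point s (n, p + u *\<^sub>R (\<alpha>, \<beta>))"
    and 2: "\<exists>\<epsilon>>0. \<exists>n p. \<forall>u\<in>{0..\<epsilon>}. p - u *\<^sub>R (\<alpha>, \<beta>) \<in> unit_square \<and>
        \<gamma> (- t - u) = staircase_point s (n, p - u *\<^sub>R (\<alpha>, \<beta>))" for t
    unfolding flow_line_def by blast+
  have eqs: "p + u *\<^sub>R (- \<alpha>, - \<beta>) = p - u *\<^sub>R (\<alpha>, \<beta>)" "p - u *\<^sub>R (- \<alpha>, - \<beta>) = p + u *\<^sub>R (\<alpha>, \<beta>)"
    "- (t + u) = - t - u" "- (t - u) = - t + u" for p t u
    by (cases p; simp)+
  have "flow_line s (- \<alpha>, - \<beta>) (\<lambda>t. \<gamma> (- t))"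
    unfolding flow_line_def eqs using 1 2 by blast
  then show "regular_orbit s (- \<alpha>, - \<beta>) (\<lambda>t. \<gamma> (- t))"
    using regular by (simp add: regular_orbit_def)
qed (use \<alpha>_nz \<beta>_nz in auto)

lemma translated: "regular_flow s \<alpha> \<beta> (\<lambda>t. \<gamma> (t + T))"
proof
  have "flow_line s (\<alpha>, \<beta>) \<gamma>" using regular by (simp add: regular_orbit_def)
  then have 1: "\<exists>\<epsilon>>0. \<exists>n p. \<forall>u\<in>{0..\<epsilon>}. p + u *\<^sub>R (\<alpha>, \<beta>) \<in> unit_square \<and>
        \<gamma> (t + T + u) = staircase_point s (n, p + u *\<^sub>R (\<alpha>, \<beta>))"
    and 2: "\<exists>\<epsilon>>0. \<exists>n p. \<forall>u\<in>{0..\<epsilon>}. p - u *\<^sub>R (\<alpha>, \<beta>) \<in> unit_square \<and>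
        \<gamma> (t + T - u) = staircase_point s (n, p - u *\<^sub>R (\<alpha>, \<beta>))" for t
    unfolding flow_line_def by blast+
  have eqs: "t + u + T = t + T + u" "t - u + T = t + T - u" for t u by simp_all
  have "flow_line s (\<alpha>, \<beta>) (\<lambda>t. \<gamma> (t + T))"
    unfolding flow_line_def eqs using 1 2 by blast
  then show "regular_orbit s (\<alpha>, \<beta>) (\<lambda>t. \<gamma> (t + T))"
    using regular by (simp add: regular_orbit_def)
qed (use \<alpha>_nz \<beta>_nz in auto)

lemma at_point_cases:
  assumes "at_point t p" "at_point t q"
  shows "p = q \<or> glue s p q \<or> glue s q p"
proof -
  have "\<not> is_corner p"
    using assms(1) staircase_point_corner[of p s] regular
    unfolding curve_at_def regular_orbit_def by metis
  then show ?thesis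
    using assms staircase_point_eq_cases[of s p q] unfolding curve_at_def by metis
qed

lemma at_point_unique:
  assumes "at_point t (n, x, y)" "at_point t (n', x', y')" "x \<in> {0<..<1}" "y \<in> {0<..<1}"
  shows "n' = n" "x' = x" "y' = y"
  using at_point_cases[OF assms(1,2)] assms(3,4) by (auto simp: glue_iff)

text \<open>The straight segment in one square that the orbit follows just after time
  \<open>t\<close>; if the orbit is on an edge at time \<open>t\<close>, this is the square being
  entered.\<close>

definition germ :: "real \<Rightarrow> int \<Rightarrow> real \<Rightarrow> real \<Rightarrow> real \<Rightarrow> bool" where
  "germ t n x y \<epsilon> \<longleftrightarrow> \<epsilon> > 0 \<and> (\<forall>u\<in>{0..\<epsilon>}. at_point (t + u) (n, x + u * \<alpha>, y + u * \<beta>))"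

lemma germ_exists: "\<exists>n x y \<epsilon>. germ t n x y \<epsilon>"
proof -
  have "\<exists>\<epsilon>>0. \<exists>n p. \<forall>u\<in>{0..\<epsilon>}. p + u *\<^sub>R (\<alpha>, \<beta>) \<in> unit_square \<and>
        \<gamma> (t + u) = staircase_point s (n, p + u *\<^sub>R (\<alpha>, \<beta>))"
    using regular unfolding regular_orbit_def flow_line_def by blast
  then show ?thesis
    unfolding germ_def curve_at_def squares_def by fastforce
qed

lemma germ_start: "germ t n x y \<epsilon> \<Longrightarrow> at_point t (n, x, y)"
  unfolding germ_def by (force dest: bspec[of _ _ 0])

lemma germ_interior:
  assumes "germ t n x y \<epsilon>" "u \<in> {0<..<\<epsilon>}"
  shows "x + u * \<alpha> \<in> {0<..<1}" "y + u * \<beta> \<in> {0<..<1}" "at_point (t + u) (n, x + u * \<alpha>, y + u * \<beta>)"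
proof -
  have *: "at_point (t + u) (n, x + u * \<alpha>, y + u * \<beta>)" if "u \<in> {0..\<epsilon>}" for u
    using that assms(1) by (auto simp: germ_def)
  show "x + u * \<alpha> \<in> {0<..<1}" "y + u * \<beta> \<in> {0<..<1}"
    using curve_at_unit[OF *[of 0]] curve_at_unit[OF *[of \<epsilon>]] assms(2) \<alpha>_nz \<beta>_nz
    by (intro interior_of_ends[where e = \<epsilon>]; simp)+
  show "at_point (t + u) (n, x + u * \<alpha>, y + u * \<beta>)" using *[of u] assms(2) by auto
qed

lemma at_point_cong:
  assumes "at_point t (n, x, y)" "at_point t (n', x', y')"
  shows "x - x' \<in> \<int>" "y - y' \<in> \<int>"
  using at_point_cases[OF assms] by (auto simp: glue_iff)

text \<open>The segment is inside the open square right after its start, so it cannot start on an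
  edge towards which it moves. This selects one of the two representatives of an edge point.\<close>

lemma germ_enters:
  assumes "germ t n x y \<epsilon>"
  shows "\<alpha> > 0 \<Longrightarrow> x < 1" "\<alpha> < 0 \<Longrightarrow> x > 0" "\<beta> > 0 \<Longrightarrow> y < 1" "\<beta> < 0 \<Longrightarrow> y > 0"
proof -
  have "\<epsilon> / 2 > 0" "\<epsilon> / 2 \<in> {0<..<\<epsilon>}" using assms by (auto simp: germ_def)
  moreover from this have "x + \<epsilon> / 2 * \<alpha> \<in> {0<..<1}" "y + \<epsilon> / 2 * \<beta> \<in> {0<..<1}"
    using germ_interior[OF assms] by blast+
  moreover note mult_pos_pos[of "\<epsilon> / 2" \<alpha>] mult_pos_pos[of "\<epsilon> / 2" \<beta>]
      mult_pos_neg[of "\<epsilon> / 2" \<alpha>] mult_pos_neg[of "\<epsilon> / 2" \<beta>]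
  ultimately show "\<alpha> > 0 \<Longrightarrow> x < 1" "\<alpha> < 0 \<Longrightarrow> x > 0" "\<beta> > 0 \<Longrightarrow> y < 1" "\<beta> < 0 \<Longrightarrow> y > 0"
    unfolding greaterThanLessThan_iff by linarith+
qed

lemma germ_unique:
  assumes "germ t n x y \<epsilon>" "at_point t (n', x', y')"
    and "\<alpha> > 0 \<Longrightarrow> x' < 1" "\<alpha> < 0 \<Longrightarrow> x' > 0" "\<beta> > 0 \<Longrightarrow> y' < 1" "\<beta> < 0 \<Longrightarrow> y' > 0"
  shows "n' = n" "x' = x" "y' = y"
  using at_point_cases[OF germ_start[OF assms(1)] assms(2)] germ_enters[OF assms(1)] assms(3-)
    \<alpha>_nz[unfolded neq_iff] \<beta>_nz[unfolded neq_iff]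
  by (auto simp: glue_iff)

end

section \<open>Uniqueness of regular orbits\<close>

lemma regular_flow_eq_forward:
  assumes "regular_flow s \<alpha> \<beta> \<gamma>" "regular_flow s \<alpha> \<beta> \<gamma>'"
  shows "\<exists>\<epsilon>>0. \<forall>u\<in>{0<..<\<epsilon>}. \<gamma> (t + u) = \<gamma>' (t + u) \<longleftrightarrow> \<gamma> t = \<gamma>' t"
proof -
  interpret A: regular_flow s \<alpha> \<beta> \<gamma> by fact
  interpret B: regular_flow s \<alpha> \<beta> \<gamma>' by fact
  obtain n x y \<epsilon> where g: "A.germ t n x y \<epsilon>" using A.germ_exists by blast
  obtain n' x' y' \<epsilon>' where g': "B.germ t n' x' y' \<epsilon>'" using B.germ_exists by blast
  have pos: "\<epsilon> > 0" "\<epsilon>' > 0" using g g' by (auto simp: A.germ_def B.germ_def)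
  have at: "\<gamma> t = staircase_point s (n, x, y)" "\<gamma>' t = staircase_point s (n', x', y')"
    using A.germ_start[OF g] B.germ_start[OF g'] by (auto simp: curve_at_def)
  \<comment> \<open>Both directions are required: the truth value of agreement, not only agreement
    itself, has to be locally constant.\<close>
  have "\<gamma> (t + u) = \<gamma>' (t + u) \<longleftrightarrow> \<gamma> t = \<gamma>' t" if "u \<in> {0<..<min \<epsilon> \<epsilon>'}" for u
  proof
    have u: "u \<in> {0<..<\<epsilon>}" "u \<in> {0<..<\<epsilon>'}" using that by auto
    note i = A.germ_interior[OF g u(1)] and i' = B.germ_interior[OF g' u(2)]
    show "\<gamma> (t + u) = \<gamma>' (t + u)" if "\<gamma> t = \<gamma>' t"
    proof -
      have "A.at_point t (n', x', y')"
        using B.germ_start[OF g'] that by (simp add: curve_at_def)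
      then have "n' = n" "x' = x" "y' = y"
        using A.germ_unique[OF g] B.germ_enters[OF g'] by blast+
      then show ?thesis using i(3) i'(3) by (simp add: curve_at_def)
    qed
    show "\<gamma> t = \<gamma>' t" if "\<gamma> (t + u) = \<gamma>' (t + u)"
    proof -
      have "A.at_point (t + u) (n', x' + u * \<alpha>, y' + u * \<beta>)"
        using i'(3) that by (simp add: curve_at_def)
      then have "n' = n" "x' + u * \<alpha> = x + u * \<alpha>" "y' + u * \<beta> = y + u * \<beta>"
        using A.at_point_unique[OF i(3) _ i(1,2)] by blast+
      then show ?thesis using at by simp
    qed
  qed
  then show ?thesis using pos by (intro exI[of _ "min \<epsilon> \<epsilon>'"]) auto
qed

lemma regular_flow_unique:
  assumes "regular_flow s \<alpha> \<beta> \<gamma>" "regular_flow s \<alpha> \<beta> \<gamma>'" "\<gamma> t = \<gamma>' t"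
  shows "\<gamma> t' = \<gamma>' t'"
proof -
  have "(\<gamma> t = \<gamma>' t) = (\<gamma> t' = \<gamma>' t')"
  proof (rule connected_local_const_sides[of UNIV])
    fix r :: real
    show "\<exists>\<epsilon>>0. \<forall>u\<in>{0<..<\<epsilon>}. r + u \<in> UNIV \<longrightarrow> (\<gamma> (r + u) = \<gamma>' (r + u)) = (\<gamma> r = \<gamma>' r)"
      using regular_flow_eq_forward[OF assms(1,2)] by simp
    show "\<exists>\<epsilon>>0. \<forall>u\<in>{0<..<\<epsilon>}. r - u \<in> UNIV \<longrightarrow> (\<gamma> (r - u) = \<gamma>' (r - u)) = (\<gamma> r = \<gamma>' r)"
      using regular_flow_eq_forward[OF assms(1,2)[THEN regular_flow.reversed], of "- r"] by simp
  qed auto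
  then show ?thesis using assms(3) by simp
qed

text \<open>The orbit and its translate by \<open>b - a\<close> agree at time \<open>a\<close>,
  hence always.\<close>

lemma (in regular_flow) periodic_if_recurs:
  assumes "\<gamma> a = \<gamma> b" "a < b"
  shows "periodic_orbit \<gamma>"
proof -
  have "\<gamma> (t + (b - a)) = \<gamma> t" for t
    using regular_flow_unique[OF translated[of "b - a"] regular_flow_axioms, of a t] assms(1) by simp
  then show ?thesis using assms(2) unfolding periodic_orbit_def by (intro exI[of _ "b - a"]) auto
qed

section \<open>Projection to the torus\<close>

lemma edge_coordinate:
  fixes x X :: real
  assumes "x \<in> {0..1}" "x - X \<in> \<int>"
  shows "X \<in> \<int> \<longleftrightarrow> x = 0 \<or> x = 1"
proof
  assume "X \<in> \<int>"
  then have "x \<in> \<int>" using Ints_add[OF assms(2)] by fastforce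
  then obtain k where k: "x = of_int k" by (auto elim: Ints_cases)
  then have "0 \<le> k" "k \<le> 1" using assms(1) by auto
  then have "k = 0 \<or> k = 1" by linarith
  then show "x = 0 \<or> x = 1" using k by auto
next
  assume "x = 0 \<or> x = 1"
  then have "x \<in> \<int>" by auto
  from Ints_diff[OF this assms(2)] show "X \<in> \<int>" by simp
qed

context regular_flow
begin

definition left_germ :: "real \<Rightarrow> int \<Rightarrow> real \<Rightarrow> real \<Rightarrow> real \<Rightarrow> bool" where
  "left_germ t = regular_flow.germ s (- \<alpha>) (- \<beta>) (\<lambda>t. \<gamma> (- t)) (- t)"

lemma left_germ_exists: "\<exists>n x y \<epsilon>. left_germ t n x y \<epsilon>"
  unfolding left_germ_def by (rule regular_flow.germ_exists[OF reversed])

lemma reversed_point: "curve_at (\<lambda>t. \<gamma> (- t)) s t p \<longleftrightarrow> at_point (- t) p"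
  by (simp add: curve_at_def)

lemma left_germ_start: "left_germ t n x y \<epsilon> \<Longrightarrow> at_point t (n, x, y)"
  unfolding left_germ_def
  by (auto simp: reversed_point dest!: regular_flow.germ_start[OF reversed])

lemma left_germ_interior:
  assumes "left_germ t n x y \<epsilon>" "u \<in> {0<..<\<epsilon>}"
  shows "x - u * \<alpha> \<in> {0<..<1}" "y - u * \<beta> \<in> {0<..<1}" "at_point (t - u) (n, x - u * \<alpha>, y - u * \<beta>)"
  using regular_flow.germ_interior[OF reversed assms(1)[unfolded left_germ_def] assms(2)]
  by (auto simp: reversed_point)

lemma left_germ_enters:
  assumes "left_germ t n x y \<epsilon>"
  shows "\<alpha> > 0 \<Longrightarrow> x > 0" "\<alpha> < 0 \<Longrightarrow> x < 1" "\<beta> > 0 \<Longrightarrow> y > 0" "\<beta> < 0 \<Longrightarrow> y < 1"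
  using regular_flow.germ_enters[OF reversed assms[unfolded left_germ_def]] by auto

lemma germ_pos: "germ t n x y \<epsilon> \<Longrightarrow> \<epsilon> > 0"
  by (simp add: germ_def)

lemma left_germ_pos: "left_germ t n x y \<epsilon> \<Longrightarrow> \<epsilon> > 0"
  unfolding left_germ_def by (rule regular_flow.germ_pos[OF reversed])

text \<open>Gluings change coordinates by integers, so the orbit projects to a straight line on the
  torus. Whether a point lies on the expected line does not depend on its representative
  (\<open>Q_iff\<close>) and is locally constant in time.\<close>

lemma coordinates_exist:
  "\<exists>x0 y0. \<forall>t n x y. at_point t (n, x, y) \<longrightarrow> x - (x0 + t * \<alpha>) \<in> \<int> \<and> y - (y0 + t * \<beta>) \<in> \<int>"
proof -
  obtain n0 x0 y0 \<epsilon>0 where g0: "germ 0 n0 x0 y0 \<epsilon>0" using germ_exists by blast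
  define Q where "Q t \<longleftrightarrow> (\<exists>n x y. at_point t (n, x, y) \<and>
    x - (x0 + t * \<alpha>) \<in> \<int> \<and> y - (y0 + t * \<beta>) \<in> \<int>)" for t
  have Q_iff: "Q t \<longleftrightarrow> x - (x0 + t * \<alpha>) \<in> \<int> \<and> y - (y0 + t * \<beta>) \<in> \<int>"
    if "at_point t (n, x, y)" for t n x y
  proof
    assume "Q t"
    then obtain n' x' y' where *: "at_point t (n', x', y')"
      "x' - (x0 + t * \<alpha>) \<in> \<int>" "y' - (y0 + t * \<beta>) \<in> \<int>" unfolding Q_def by blast
    then show "x - (x0 + t * \<alpha>) \<in> \<int> \<and> y - (y0 + t * \<beta>) \<in> \<int>"
      using Ints_add[OF at_point_cong(1)[OF that *(1)] *(2)] Ints_add[OF at_point_cong(2)[OF that *(1)] *(3)]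
      by (simp add: algebra_simps)
  qed (use that in \<open>auto simp: Q_def\<close>)
  have "Q 0 = Q t" for t
  proof (rule connected_local_const_sides[of UNIV])
    fix t
    obtain n x y \<epsilon> where g: "germ t n x y \<epsilon>" using germ_exists by blast
    have "Q (t + u) = Q t" if "u \<in> {0<..<\<epsilon>}" for u
      using Q_iff[OF germ_start[OF g]] Q_iff[OF germ_interior(3)[OF g that]]
      by (simp add: algebra_simps)
    then show "\<exists>\<epsilon>>0. \<forall>u\<in>{0<..<\<epsilon>}. t + u \<in> UNIV \<longrightarrow> Q (t + u) = Q t"
      using germ_pos[OF g] by blast
    obtain n x y \<epsilon> where g: "left_germ t n x y \<epsilon>" using left_germ_exists by blast
    have "Q (t - u) = Q t" if "u \<in> {0<..<\<epsilon>}" for u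
      using Q_iff[OF left_germ_start[OF g]] Q_iff[OF left_germ_interior(3)[OF g that]]
      by (simp add: algebra_simps)
    then show "\<exists>\<epsilon>>0. \<forall>u\<in>{0<..<\<epsilon>}. t - u \<in> UNIV \<longrightarrow> Q (t - u) = Q t"
      using left_germ_pos[OF g] by blast
  qed auto
  moreover have "Q 0" using Q_iff[OF germ_start[OF g0]] by simp
  ultimately have "Q t" for t by simp
  then show ?thesis using Q_iff by blast
qed

end

section \<open>Edge crossings of a regular orbit\<close>

locale regular_flow_coordinates = regular_flow +
  fixes x0 y0 :: real
  assumes coordinates: "curve_at \<gamma> s t (n, x, y) \<Longrightarrow>
    x - (x0 + t * \<alpha>) \<in> \<int> \<and> y - (y0 + t * \<beta>) \<in> \<int>"
begin

definition crosses_x :: "real \<Rightarrow> bool" where "crosses_x t \<longleftrightarrow> x0 + t * \<alpha> \<in> \<int>"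
definition crosses_y :: "real \<Rightarrow> bool" where "crosses_y t \<longleftrightarrow> y0 + t * \<beta> \<in> \<int>"

text \<open>Determined by the orbit at times in the interior of a square; on an edge the choice may
  fall on either side.\<close>

definition square_at :: "real \<Rightarrow> int" where
  "square_at t = (SOME n. \<exists>x y. at_point t (n, x, y))"

lemma square_at_eq:
  assumes "at_point t (n, x, y)" "x \<in> {0<..<1}" "y \<in> {0<..<1}"
  shows "square_at t = n"
  unfolding square_at_def
  by (rule some_equality) (use assms at_point_unique[OF assms(1) _ assms(2,3)] in blast)+

lemma at_point_crosses:
  assumes "at_point t (n, x, y)"
  shows "crosses_x t \<longleftrightarrow> x = 0 \<or> x = 1" "crosses_y t \<longleftrightarrow> y = 0 \<or> y = 1"
  using edge_coordinate coordinates[OF assms] curve_at_unit[OF assms]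
  unfolding crosses_x_def crosses_y_def by blast+

lemma generic_interior:
  assumes "at_point t (n, x, y)" "\<not> crosses_x t" "\<not> crosses_y t"
  shows "x \<in> {0<..<1}" "y \<in> {0<..<1}"
  using at_point_crosses[OF assms(1)] curve_at_unit[OF assms(1)] assms(2,3) by auto

lemma not_crosses_both: "\<not> (crosses_x t \<and> crosses_y t)"
proof
  assume *: "crosses_x t \<and> crosses_y t"
  obtain n x y \<epsilon> where "germ t n x y \<epsilon>" using germ_exists by blast
  from germ_start[OF this] have at: "at_point t (n, x, y)" .
  then have "is_corner (n, x, y)" using at_point_crosses[OF at] * by auto
  then show False
    using staircase_point_corner[of "(n, x, y)" s] at regular
    unfolding curve_at_def regular_orbit_def by metis
qed

lemma square_at_germ:
  assumes "germ t n x y \<epsilon>" "u \<in> {0<..<\<epsilon>}"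
  shows "square_at (t + u) = n"
  using germ_interior[OF assms] square_at_eq by blast

lemma square_at_left_germ:
  assumes "left_germ t n x y \<epsilon>" "u \<in> {0<..<\<epsilon>}"
  shows "square_at (t - u) = n"
  using left_germ_interior[OF assms] square_at_eq by blast

lemma square_at_const:
  assumes "connected A" "a \<in> A" "b \<in> A"
    and generic: "\<And>t. t \<in> A \<Longrightarrow> \<not> crosses_x t \<and> \<not> crosses_y t"
  shows "square_at a = square_at b"
proof (rule connected_local_const_sides[OF assms(1-3)])
  fix t assume "t \<in> A"
  have sq: "square_at t = n" if "at_point t (n, x, y)" for n x y
    using generic_interior[OF that] generic[OF \<open>t \<in> A\<close>] square_at_eq[OF that] by blast
  obtain n x y \<epsilon> where g: "germ t n x y \<epsilon>" using germ_exists by blast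
  then show "\<exists>\<epsilon>>0. \<forall>u\<in>{0<..<\<epsilon>}. t + u \<in> A \<longrightarrow> square_at (t + u) = square_at t"
    using sq[OF germ_start[OF g]] square_at_germ[OF g] germ_pos[OF g] by blast
  obtain n x y \<epsilon> where g: "left_germ t n x y \<epsilon>" using left_germ_exists by blast
  then show "\<exists>\<epsilon>>0. \<forall>u\<in>{0<..<\<epsilon>}. t - u \<in> A \<longrightarrow> square_at (t - u) = square_at t"
    using sq[OF left_germ_start[OF g]] square_at_left_germ[OF g] left_germ_pos[OF g] by blast
qed

text \<open>The germs on the two sides of \<tau> lie in the squares occupied at \<open>a\<close> and
  at \<open>b\<close>. The strict inequalities record that the first square is being left and the
  second entered.\<close>

lemma crossing:
  assumes "a < \<tau>" "\<tau> < b"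
    and generic: "\<And>t. t \<in> {a..b} \<Longrightarrow> t \<noteq> \<tau> \<Longrightarrow> \<not> crosses_x t \<and> \<not> crosses_y t"
  obtains x y x' y' where "at_point \<tau> (square_at a, x, y)" "at_point \<tau> (square_at b, x', y')"
    "\<alpha> > 0 \<Longrightarrow> x > 0 \<and> x' < 1" "\<alpha> < 0 \<Longrightarrow> x < 1 \<and> x' > 0"
    "\<beta> > 0 \<Longrightarrow> y > 0 \<and> y' < 1" "\<beta> < 0 \<Longrightarrow> y < 1 \<and> y' > 0"
proof -
  obtain n x y \<epsilon> where g: "left_germ \<tau> n x y \<epsilon>" using left_germ_exists by blast
  obtain n' x' y' \<epsilon>' where g': "germ \<tau> n' x' y' \<epsilon>'" using germ_exists by blast
  define u where "u = min \<epsilon> (\<tau> - a) / 2"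
  define u' where "u' = min \<epsilon>' (b - \<tau>) / 2"
  have u: "u \<in> {0<..<\<epsilon>}" "a \<le> \<tau> - u" "u > 0" using left_germ_pos[OF g] assms by (auto simp: u_def min_def field_simps)
  have u': "u' \<in> {0<..<\<epsilon>'}" "\<tau> + u' \<le> b" "u' > 0" using germ_pos[OF g'] assms by (auto simp: u'_def min_def field_simps)
  have "square_at a = square_at (\<tau> - u)"
    by (rule square_at_const[of "{a..\<tau> - u}"]) (use u generic assms in auto)
  then have 1: "square_at a = n" using square_at_left_germ[OF g u(1)] by simp
  have "square_at (\<tau> + u') = square_at b"
    by (rule square_at_const[of "{\<tau> + u'..b}"]) (use u' generic assms in auto)
  then have 2: "square_at b = n'" using square_at_germ[OF g' u'(1)] by simp
  show ?thesis
    using that[of x y x' y'] left_germ_start[OF g] germ_start[OF g'] left_germ_enters[OF g] germ_enters[OF g']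
    unfolding 1 2 by blast
qed

text \<open>The strict inequalities put the two representatives on opposite vertical edges, so they
  are distinct and must be glued horizontally.\<close>

lemma crossing_x:
  assumes "a < \<tau>" "\<tau> < b" "crosses_x \<tau>"
    and generic: "\<And>t. t \<in> {a..b} \<Longrightarrow> t \<noteq> \<tau> \<Longrightarrow> \<not> crosses_x t \<and> \<not> crosses_y t"
  shows "adjacent (right_of s) (square_at a) (square_at b)"
proof -
  obtain x y x' y' where c: "at_point \<tau> (square_at a, x, y)" "at_point \<tau> (square_at b, x', y')"
    "\<alpha> > 0 \<Longrightarrow> x > 0 \<and> x' < 1" "\<alpha> < 0 \<Longrightarrow> x < 1 \<and> x' > 0"
    using crossing[OF assms(1,2) generic] by metis
  have "x = 0 \<or> x = 1" "x' = 0 \<or> x' = 1"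
    using at_point_crosses(1)[OF c(1)] at_point_crosses(1)[OF c(2)] assms(3) by auto
  then have "x \<noteq> x'" using c(3,4) \<alpha>_nz[unfolded neq_iff] by auto
  then show ?thesis
    using at_point_cases[OF c(1,2)] by (auto simp: glue_iff adjacent_def)
qed

lemma crossing_y:
  assumes "a < \<tau>" "\<tau> < b" "crosses_y \<tau>"
    and generic: "\<And>t. t \<in> {a..b} \<Longrightarrow> t \<noteq> \<tau> \<Longrightarrow> \<not> crosses_x t \<and> \<not> crosses_y t"
  shows "adjacent (above s) (square_at a) (square_at b)"
proof -
  obtain x y x' y' where c: "at_point \<tau> (square_at a, x, y)" "at_point \<tau> (square_at b, x', y')"
    "\<beta> > 0 \<Longrightarrow> y > 0 \<and> y' < 1" "\<beta> < 0 \<Longrightarrow> y < 1 \<and> y' > 0"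
    using crossing[OF assms(1,2) generic] by metis
  have "y = 0 \<or> y = 1" "y' = 0 \<or> y' = 1"
    using at_point_crosses(2)[OF c(1)] at_point_crosses(2)[OF c(2)] assms(3) by auto
  then have "y \<noteq> y'" using c(3,4) \<beta>_nz[unfolded neq_iff] by auto
  then show ?thesis
    using at_point_cases[OF c(1,2)] by (auto simp: glue_iff adjacent_def)
qed

lemma orbit_eq:
  assumes "square_at t = square_at t'" "\<not> crosses_x t \<and> \<not> crosses_y t"
    and "(t' - t) * \<alpha> \<in> \<int>" "(t' - t) * \<beta> \<in> \<int>"
  shows "\<gamma> t = \<gamma> t'"
proof -
  have "x0 + t' * \<alpha> = (x0 + t * \<alpha>) + (t' - t) * \<alpha>" "y0 + t' * \<beta> = (y0 + t * \<beta>) + (t' - t) * \<beta>"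
    by (simp_all add: algebra_simps)
  then have gen': "\<not> crosses_x t' \<and> \<not> crosses_y t'"
    using assms(2) unfolding crosses_x_def crosses_y_def
    using add_in_Ints_iff_right[OF assms(3)] add_in_Ints_iff_right[OF assms(4)] by metis
  obtain n x y \<epsilon> n' x' y' \<epsilon>' where "germ t n x y \<epsilon>" "germ t' n' x' y' \<epsilon>'" using germ_exists by metis
  then have at: "at_point t (n, x, y)" "at_point t' (n', x', y')" using germ_start by blast+
  have in1: "x \<in> {0<..<1}" "y \<in> {0<..<1}" "x' \<in> {0<..<1}" "y' \<in> {0<..<1}"
    using generic_interior[OF at(1)] generic_interior[OF at(2)] assms(2) gen' by blast+
  then have "n = n'"
    using square_at_eq[OF at(1)] square_at_eq[OF at(2)] assms(1) by simp
  have "x' - (x0 + t' * \<alpha>) - (x - (x0 + t * \<alpha>)) \<in> \<int>" "y' - (y0 + t' * \<beta>) - (y - (y0 + t * \<beta>)) \<in> \<int>"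
    using coordinates[OF at(1)] coordinates[OF at(2)] Ints_diff by blast+
  from Ints_add[OF this(1) assms(3)] Ints_add[OF this(2) assms(4)]
  have "x' - x \<in> \<int>" "y' - y \<in> \<int>" by (simp_all add: algebra_simps)
  then have "x' = x" "y' = y" using Ints_diff_unit in1 by (metis atLeastAtMost_iff greaterThanLessThan_iff less_imp_le)+
  then show ?thesis using at \<open>n = n'\<close> by (simp add: curve_at_def)
qed

end

section \<open>Sampling an orbit of rational slope\<close>

lemma Ints_offset_unique:
  fixes z f :: real and k :: int
  assumes "z \<in> \<int>" "0 < f" "f < 1" "z \<in> {f + of_int k..f + of_int k + 1}"
  shows "z = of_int (k + 1)"
proof -
  obtain m where m: "z = of_int m" using assms(1) by (auto elim: Ints_cases)
  then have "k < m" "m < k + 2" using assms by auto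
  then have "m = k + 1" by linarith
  then show ?thesis using m by simp
qed

lemma Ints_iff_scaled:
  fixes X :: real and p q :: int
  assumes "p \<noteq> 0" "q \<noteq> 0"
  shows "X \<in> \<int> \<longleftrightarrow> (\<exists>m. of_int (2 * \<bar>p\<bar> * sgn q) * X = of_int (2 * \<bar>p\<bar> * m))"
proof
  assume "X \<in> \<int>"
  then obtain k where "X = of_int k" by (auto elim: Ints_cases)
  then show "\<exists>m. of_int (2 * \<bar>p\<bar> * sgn q) * X = of_int (2 * \<bar>p\<bar> * m)"
    by (intro exI[of _ "sgn q * k"]) simp
next
  assume "\<exists>m. of_int (2 * \<bar>p\<bar> * sgn q) * X = of_int (2 * \<bar>p\<bar> * m)"
  then obtain m where m: "of_int (2 * \<bar>p\<bar> * sgn q) * X = of_int (2 * \<bar>p\<bar> * m)" by blast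
  then have "of_int (sgn q) * X = of_int m" using assms(1) by simp
  moreover have "real_of_int (sgn q) * of_int (sgn q) = 1" using assms(2) by (cases "q > 0") auto
  ultimately have "X = of_int (sgn q) * of_int m"
    by (metis mult.assoc mult_1)
  then show "X \<in> \<int>" by simp
qed

locale rational_flow = regular_flow_coordinates +
  fixes c :: real and p q :: int
  assumes c_pos: "c > 0" and p_nz: "p \<noteq> 0" and q_nz: "q \<noteq> 0" and odd_pq: "odd (p + q)"
    and coprime: "coprime p q" and \<alpha>_eq: "\<alpha> = c * of_int q" and \<beta>_eq: "\<beta> = c * of_int p"
begin

text \<open>Rescaled coordinates, both of which grow by 1 in time \<open>\<delta>\<close>.\<close>

definition scaled_x :: "real \<Rightarrow> real" where "scaled_x t = of_int (2 * \<bar>p\<bar> * sgn q) * (x0 + t * \<alpha>)"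
definition scaled_y :: "real \<Rightarrow> real" where "scaled_y t = of_int (2 * \<bar>q\<bar> * sgn p) * (y0 + t * \<beta>)"
definition \<delta> :: real where "\<delta> = 1 / (c * of_int (2 * \<bar>p\<bar> * \<bar>q\<bar>))"

lemma \<delta>_pos: "\<delta> > 0"
  using c_pos p_nz q_nz by (simp add: \<delta>_def)

lemma scaled_x_add: "scaled_x (t + u * \<delta>) = scaled_x t + u"
proof -
  have "real_of_int (2 * \<bar>p\<bar> * sgn q) * of_int q = of_int (2 * \<bar>p\<bar> * \<bar>q\<bar>)"
    by (simp add: abs_sgn)
  then have "of_int (2 * \<bar>p\<bar> * sgn q) * \<alpha> * \<delta> = 1"
    using c_pos p_nz q_nz unfolding \<alpha>_eq \<delta>_def by (simp add: field_simps)
  then show ?thesis unfolding scaled_x_def by (simp add: algebra_simps)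
qed

lemma scaled_y_add: "scaled_y (t + u * \<delta>) = scaled_y t + u"
proof -
  have "real_of_int (2 * \<bar>q\<bar> * sgn p) * of_int p = of_int (2 * \<bar>p\<bar> * \<bar>q\<bar>)"
    by (simp add: abs_sgn)
  then have "of_int (2 * \<bar>q\<bar> * sgn p) * \<beta> * \<delta> = 1"
    using c_pos p_nz q_nz unfolding \<beta>_eq \<delta>_def by (simp add: field_simps)
  then show ?thesis unfolding scaled_y_def by (simp add: algebra_simps)
qed

lemma scaled_diff_const: "scaled_x t - scaled_y t = scaled_x 0 - scaled_y 0"
  using scaled_x_add[of 0 "t / \<delta>"] scaled_y_add[of 0 "t / \<delta>"] \<delta>_pos by simp

lemma crosses_x_iff: "crosses_x t \<longleftrightarrow> (\<exists>m. scaled_x t = of_int (2 * \<bar>p\<bar> * m))"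
  unfolding crosses_x_def scaled_x_def by (rule Ints_iff_scaled[OF p_nz q_nz])

lemma crosses_y_iff: "crosses_y t \<longleftrightarrow> (\<exists>m. scaled_y t = of_int (2 * \<bar>q\<bar> * m))"
  unfolding crosses_y_def scaled_y_def by (rule Ints_iff_scaled[OF q_nz p_nz])

text \<open>Otherwise the line meets the lattice, by Bezout.\<close>

lemma half_diff_not_Ints: "(scaled_x 0 - scaled_y 0) / 2 \<notin> \<int>"
proof
  assume "(scaled_x 0 - scaled_y 0) / 2 \<in> \<int>"
  then obtain m where m: "scaled_x 0 - scaled_y 0 = 2 * of_int m" by (auto elim: Ints_cases)
  obtain u v where "u * \<bar>p\<bar> + v * \<bar>q\<bar> = gcd \<bar>p\<bar> \<bar>q\<bar>" using bezout_int by blast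
  then have uv: "u * \<bar>p\<bar> + v * \<bar>q\<bar> = 1" using coprime by (simp add: coprime_iff_gcd_eq_1)
  \<comment> \<open>At this time \<open>scaled_x\<close> is
    \<open>2 * \<bar>p\<bar> * (m * u)\<close>, and by the Bezout identity \<open>scaled_y\<close>,
    smaller by \<open>2 * m\<close>, is a multiple of \<open>2 * \<bar>q\<bar>\<close>: both edges
    would be hit at once.\<close>
  define t where "t = (of_int (2 * \<bar>p\<bar> * (m * u)) - scaled_x 0) * \<delta>"
  have "scaled_x t = of_int (2 * \<bar>p\<bar> * (m * u))"
    using scaled_x_add[of 0 "of_int (2 * \<bar>p\<bar> * (m * u)) - scaled_x 0"] by (simp add: t_def)
  moreover from this have "scaled_y t = of_int (2 * (\<bar>p\<bar> * (m * u)) - 2 * m)" using scaled_diff_const[of t] m by simp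
  moreover have "2 * (\<bar>p\<bar> * (m * u)) - 2 * m = 2 * \<bar>q\<bar> * (- (m * v))"
  proof -
    have "2 * m = 2 * m * (u * \<bar>p\<bar> + v * \<bar>q\<bar>)" by (simp add: uv)
    then show ?thesis by (simp add: algebra_simps)
  qed
  ultimately show False
    using not_crosses_both[of t] crosses_x_iff crosses_y_iff by metis
qed

text \<open>At the sample times the rescaled coordinates are \<open>phase\<close> and \<open>- phase\<close> modulo 1, so during a step
  they pass one integer each, at different times; by the choice of \<open>j0\<close> these two integers have
  different parity, so at most one of the passages is an edge crossing.\<close>

definition phase :: real where "phase = frac ((scaled_x 0 - scaled_y 0) / 2)"
definition j0 :: int where "j0 = - 2 * \<lfloor>(scaled_x 0 - scaled_y 0) / 2\<rfloor>"
definition t0 :: real where "t0 = (phase - scaled_x 0) * \<delta>"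
definition sample :: "nat \<Rightarrow> real" where "sample k = t0 + of_nat k * \<delta>"

lemma phase_bounds: "0 < phase" "phase < 1"
  using half_diff_not_Ints by (auto simp: phase_def frac_lt_1)

lemma scaled_x_sample: "scaled_x (sample k + u * \<delta>) = phase + of_nat k + u"
  using scaled_x_add[of 0 "phase - scaled_x 0 + of_nat k + u"] by (simp add: sample_def t0_def algebra_simps)

lemma scaled_y_sample: "scaled_y (sample k + u * \<delta>) = of_int j0 - phase + of_nat k + u"
proof -
  have "scaled_x 0 - scaled_y 0 = 2 * phase - of_int j0" by (simp add: phase_def j0_def frac_def)
  then show ?thesis using scaled_diff_const[of "sample k + u * \<delta>"] scaled_x_sample[of k u] by simp
qed

lemma crosses_x_sample:
  assumes "u \<in> {0..1}" "crosses_x (sample k + u * \<delta>)"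
  shows "u = 1 - phase \<and> 2 * \<bar>p\<bar> dvd 1 + int k"
proof -
  obtain m where m: "scaled_x (sample k + u * \<delta>) = of_int (2 * \<bar>p\<bar> * m)" using assms crosses_x_iff by blast
  have scaled_x: "scaled_x (sample k + u * \<delta>) = of_int (int k + 1)"
    by (rule Ints_offset_unique[where f = phase]) (use assms phase_bounds m in \<open>auto simp: scaled_x_sample\<close>)
  then have "u = 1 - phase" using scaled_x_sample[of k u] by simp
  moreover have "2 * \<bar>p\<bar> * m = int k + 1"
    using trans[OF m[symmetric] scaled_x] by (simp only: of_int_eq_iff)
  ultimately show ?thesis by (metis dvd_triv_left add.commute)
qed

lemma crosses_y_sample:
  assumes "u \<in> {0..1}" "crosses_y (sample k + u * \<delta>)"
  shows "u = phase \<and> 2 * \<bar>q\<bar> dvd j0 + int k"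
proof -
  obtain m where m: "scaled_y (sample k + u * \<delta>) = of_int (2 * \<bar>q\<bar> * m)" using assms crosses_y_iff by blast
  have scaled_y: "scaled_y (sample k + u * \<delta>) = of_int ((j0 + int k - 1) + 1)"
    \<comment> \<open>The step starts at \<open>j0 + k - phase\<close>, which has fractional part
      \<open>1 - phase\<close> above the integer \<open>j0 + k - 1\<close>.\<close>
    by (rule Ints_offset_unique[where f = "1 - phase"]) (use assms phase_bounds m in \<open>auto simp: scaled_y_sample\<close>)
  then have "u = phase" using scaled_y_sample[of k u] by simp
  moreover have "2 * \<bar>q\<bar> * m = j0 + int k"
    using trans[OF m[symmetric] scaled_y] by (simp only: of_int_eq_iff diff_add_cancel)
  ultimately show ?thesis by (metis dvd_triv_left)
qed

lemma step_time:
  assumes "t \<in> {sample k..sample (Suc k)}"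
  obtains u where "u \<in> {0..1}" "t = sample k + u * \<delta>"
proof
  show "t = sample k + ((t - sample k) / \<delta>) * \<delta>" using \<delta>_pos by simp
  show "(t - sample k) / \<delta> \<in> {0..1}" using assms \<delta>_pos by (auto simp: sample_def field_simps)
qed

lemma generic_step:
  assumes "t \<in> {sample k..sample (Suc k)}"
    and "2 * \<bar>p\<bar> dvd 1 + int k \<Longrightarrow> t \<noteq> sample k + (1 - phase) * \<delta>"
    and "2 * \<bar>q\<bar> dvd j0 + int k \<Longrightarrow> t \<noteq> sample k + phase * \<delta>"
  shows "\<not> crosses_x t \<and> \<not> crosses_y t"
proof -
  obtain u where u: "u \<in> {0..1}" "t = sample k + u * \<delta>" using step_time[OF assms(1)] .
  then show ?thesis
    using crosses_x_sample[OF u(1), of k] crosses_y_sample[OF u(1), of k] assms(2,3) by blast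
qed

lemma dvd_exclusive: "\<not> (2 * \<bar>p\<bar> dvd 1 + int k \<and> 2 * \<bar>q\<bar> dvd j0 + int k)"
proof
  assume "2 * \<bar>p\<bar> dvd 1 + int k \<and> 2 * \<bar>q\<bar> dvd j0 + int k"
  then have "even (1 + int k)" "even (j0 + int k)" using dvd_mult_left by blast+
  then show False by (simp add: j0_def)
qed

text \<open>Here \<open>i0\<close> is 1 because \<open>scaled_x\<close> runs from
  \<open>phase + k\<close> to \<open>phase + k + 1\<close> in step \<open>k\<close> and so passes
  the integer \<open>1 + k\<close>.\<close>

sublocale square_path s "\<bar>p\<bar>" "\<bar>q\<bar>" 1 j0 "\<lambda>k. square_at (sample k)"
proof
  show "\<bar>p\<bar> > 0" "\<bar>q\<bar> > 0" using p_nz q_nz by auto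
  show "odd (\<bar>p\<bar> + \<bar>q\<bar>)" using odd_pq by auto
  show "odd (1 + j0)" by (simp add: j0_def)
  fix k
  have order: "sample k < sample k + u * \<delta>" "sample k + u * \<delta> < sample (Suc k)"
    if "u \<in> {0<..<1}" for u
    using that \<delta>_pos by (auto simp: sample_def algebra_simps)
  show "adjacent (right_of s) (square_at (sample k)) (square_at (sample (Suc k)))"
    if dvd: "2 * \<bar>p\<bar> dvd 1 + int k"
  proof (rule crossing_x)
    show "sample k < sample k + (1 - phase) * \<delta>" "sample k + (1 - phase) * \<delta> < sample (Suc k)"
      using order[of "1 - phase"] phase_bounds by auto
    have "scaled_x (sample k + (1 - phase) * \<delta>) = of_int (1 + int k)" by (simp add: scaled_x_sample)
    then show "crosses_x (sample k + (1 - phase) * \<delta>)"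
      using dvd unfolding crosses_x_iff dvd_def by metis
    show "\<not> crosses_x t \<and> \<not> crosses_y t"
      if "t \<in> {sample k..sample (Suc k)}" "t \<noteq> sample k + (1 - phase) * \<delta>" for t
      using generic_step[OF that(1)] that(2) dvd dvd_exclusive[of k] by blast
  qed
  show "adjacent (above s) (square_at (sample k)) (square_at (sample (Suc k)))"
    if dvd: "2 * \<bar>q\<bar> dvd j0 + int k"
  proof (rule crossing_y)
    show "sample k < sample k + phase * \<delta>" "sample k + phase * \<delta> < sample (Suc k)"
      using order[of phase] phase_bounds by auto
    have "scaled_y (sample k + phase * \<delta>) = of_int (j0 + int k)" by (simp add: scaled_y_sample)
    then show "crosses_y (sample k + phase * \<delta>)"
      using dvd unfolding crosses_y_iff dvd_def by metis
    show "\<not> crosses_x t \<and> \<not> crosses_y t"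
      if "t \<in> {sample k..sample (Suc k)}" "t \<noteq> sample k + phase * \<delta>" for t
      using generic_step[OF that(1)] that(2) dvd dvd_exclusive[of k] by blast
  qed
  show "square_at (sample (Suc k)) = square_at (sample k)"
    if "\<not> 2 * \<bar>p\<bar> dvd 1 + int k" "\<not> 2 * \<bar>q\<bar> dvd j0 + int k"
  proof (rule square_at_const[of "{sample k..sample (Suc k)}"])
    show "\<not> crosses_x t \<and> \<not> crosses_y t" if "t \<in> {sample k..sample (Suc k)}" for t
      using generic_step[OF that] \<open>\<not> 2 * \<bar>p\<bar> dvd 1 + int k\<close>
        \<open>\<not> 2 * \<bar>q\<bar> dvd j0 + int k\<close> by blast
  qed (use \<delta>_pos in \<open>auto simp: sample_def\<close>)
qed

text \<open>One period of steps takes time \<open>1 / c\<close>, during which the line advances by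
  the lattice vector \<open>(q, p)\<close>. Returning to the same square after whole periods
  therefore means returning to the same point.\<close>

lemma periodic:
  assumes "\<And>m r. \<exists>c\<ge>m. alternating s c r" and "\<And>m r. \<exists>c\<le>m. alternating s c r"
  shows "periodic_orbit \<gamma>"
proof -
  obtain i j where ij: "i < j" "square_at (sample (period * i)) = square_at (sample (period * j))"
    using recurs[OF assms] by blast
  have "sample (period * j) - sample (period * i) = (of_nat j - of_nat i) * (of_nat period * \<delta>)"
    by (simp add: sample_def algebra_simps)
  also have "of_nat period * \<delta> = 1 / c"
  proof -
    have "real period = of_int (2 * \<bar>p\<bar> * \<bar>q\<bar>)"
      by (metis int_period of_int_of_nat_eq)
    moreover have "real_of_int (2 * \<bar>p\<bar> * \<bar>q\<bar>) \<noteq> 0" using p_nz q_nz by simp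
    moreover have "K * (1 / (c * K)) = 1 / c" if "K \<noteq> 0" for K :: real
      using that by simp
    ultimately show ?thesis
      unfolding \<delta>_def by metis
  qed
  finally have T: "sample (period * j) - sample (period * i) = (of_nat j - of_nat i) / c" by simp
  have "\<gamma> (sample (period * i)) = \<gamma> (sample (period * j))"
  proof (rule orbit_eq[OF ij(2)])
    show "\<not> crosses_x (sample (period * i)) \<and> \<not> crosses_y (sample (period * i))"
      \<comment> \<open>A crossing at \<open>u = 0\<close> would force \<open>phase\<close> to be 1
        or 0.\<close>
      using crosses_x_sample[of 0 "period * i"] crosses_y_sample[of 0 "period * i"] phase_bounds by auto
    have ints: "(of_nat j - of_nat i) / c * (c * of_int r) \<in> \<int>" for r
      using c_pos by simp
    show "(sample (period * j) - sample (period * i)) * \<alpha> \<in> \<int>"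
      by (subst T, subst \<alpha>_eq) (rule ints)
    show "(sample (period * j) - sample (period * i)) * \<beta> \<in> \<int>"
      by (subst T, subst \<beta>_eq) (rule ints)
  qed
  moreover have "sample (period * i) < sample (period * j)"
    using ij(1) \<delta>_pos period_pos by (simp add: sample_def)
  ultimately show ?thesis by (rule periodic_if_recurs)
qed

end

section \<open>Density of the periodic directions\<close>

text \<open>Dividing by the gcd reduces to lowest terms; the sum stays odd, being a factor of the
  odd number \<open>p + q\<close>, and \<open>c\<close> absorbs the gcd.\<close>

lemma rational_direction_periodic:
  assumes right: "\<And>m r. \<exists>c\<ge>m. alternating s c r" and left: "\<And>m r. \<exists>c\<le>m. alternating s c r"
    and "p \<noteq> 0" "q \<noteq> 0" "odd (p + q)" "c > 0"
    and reg: "regular_orbit s (c * of_int q, c * of_int p) \<gamma>"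
  shows "periodic_orbit \<gamma>"
proof -
  define g where "g = gcd p q"
  obtain p' q' where pq: "p = p' * g" "q = q' * g" "coprime p' q'"
    using gcd_coprime_exists[of p q] assms(3) unfolding g_def by auto
  have "g > 0" using assms(3) by (simp add: g_def)
  interpret regular_flow s "c * of_int q" "c * of_int p" \<gamma>
    by standard (use assms in auto)
  obtain x0 y0 where coords: "\<forall>t n x y. at_point t (n, x, y) \<longrightarrow>
      x - (x0 + t * (c * of_int q)) \<in> \<int> \<and> y - (y0 + t * (c * of_int p)) \<in> \<int>"
    using coordinates_exist by blast
  interpret rational_flow s "c * of_int q" "c * of_int p" \<gamma> x0 y0 "c * of_int g" p' q'
  proof
    show "odd (p' + q')" using assms(5) unfolding pq by (metis distrib_right even_mult_iff)
  qed (use coords assms pq \<open>g > 0\<close> in auto)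
  show ?thesis using periodic[OF right left] .
qed

lemma rational_direction_purely_periodic:
  assumes "\<And>m r. \<exists>c\<ge>m. alternating s c r" and "\<And>m r. \<exists>c\<le>m. alternating s c r"
    and "p \<noteq> 0" "q \<noteq> 0" "odd (p + q)"
  shows "sgn (of_int q, of_int p) \<in> purely_periodic_directions s"
proof -
  define v :: "real \<times> real" where "v = (of_int q, of_int p)"
  have "v \<noteq> 0" using assms(3) by (auto simp: v_def zero_prod_def)
  have "sgn v = (1 / norm v * of_int q, 1 / norm v * of_int p)"
    by (simp add: sgn_div_norm v_def divide_simps)
  then have "periodic_orbit \<gamma>" if "regular_orbit s (sgn v) \<gamma>" for \<gamma>
    using rational_direction_periodic[OF assms, of "1 / norm v" \<gamma>] that \<open>v \<noteq> 0\<close> by simp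
  then show ?thesis
    using \<open>v \<noteq> 0\<close> unfolding purely_periodic_directions_def v_def[symmetric] by (simp add: norm_sgn)
qed

text \<open>Numerators over \<open>2 * k\<close> that approximate \<open>a\<close> and have the
  parity of \<open>r\<close>; an even and an odd choice give components with odd sum.\<close>

definition double_floor :: "int \<Rightarrow> real \<Rightarrow> nat \<Rightarrow> int" where
  "double_floor r a k = 2 * \<lfloor>of_nat k * a\<rfloor> + r"

lemma const_plus_over_nat_tendsto: "(\<lambda>k. a + C / (2 * of_nat k)) \<longlonglongrightarrow> a" for a C :: real
  using tendsto_add[OF tendsto_const[of a] lim_const_over_n[of "C / 2"]] by simp

lemma double_floor_tendsto: "(\<lambda>k. of_int (double_floor r a k) / (2 * of_nat k)) \<longlonglongrightarrow> a"
proof (rule tendsto_sandwich)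
  show "\<forall>\<^sub>F k in sequentially. a + (of_int r - 2) / (2 * of_nat k) \<le> of_int (double_floor r a k) / (2 * of_nat k)"
    using eventually_gt_at_top[of 0]
  proof eventually_elim
    case (elim k)
    have "a + (of_int r - 2) / (2 * of_nat k) = (2 * (of_nat k * a) + of_int r - 2) / (2 * of_nat k)"
      using elim by (simp add: field_simps)
    also have "\<dots> \<le> of_int (double_floor r a k) / (2 * of_nat k)"
      unfolding double_floor_def by (rule divide_right_mono) (simp, linarith, simp)
    finally show ?case .
  qed
  show "\<forall>\<^sub>F k in sequentially. of_int (double_floor r a k) / (2 * of_nat k) \<le> a + of_int r / (2 * of_nat k)"
    using eventually_gt_at_top[of 0]
  proof eventually_elim
    case (elim k)
    have "of_int \<lfloor>of_nat k * a\<rfloor> \<le> of_nat k * a" by linarith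
    then show ?case using elim by (simp add: double_floor_def field_simps)
  qed
qed (rule const_plus_over_nat_tendsto)+

text \<open>An offset 2 with the same sign as \<open>a\<close> pushes the even numerator away from
  0. The odd numerator is nonzero by parity.\<close>

lemma double_floor_nonzero: "\<exists>r. even r \<and> (\<forall>k. double_floor r a k \<noteq> 0)"
proof (cases "a \<ge> 0")
  case True
  then have "\<lfloor>of_nat k * a\<rfloor> \<ge> 0" for k
    by simp
  then have "double_floor 2 a k \<noteq> 0" for k
    unfolding double_floor_def by (smt (verit))
  then show ?thesis by (intro exI[of _ 2]) auto
next
  case False
  then have "\<lfloor>of_nat k * a\<rfloor> \<le> 0" for k
    using mult_nonneg_nonpos[of "of_nat k" a] by (simp add: floor_le_iff)
  then have "double_floor (- 2) a k \<noteq> 0" for k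
    unfolding double_floor_def by (smt (verit))
  then show ?thesis by (intro exI[of _ "- 2"]) auto
qed

text \<open>\<open>sgn\<close> is continuous away from 0 and unaffected by positive scaling, so the
  common denominator \<open>2 * k\<close> drops out and integer vectors remain.\<close>

lemma sphere_subset_closure:
  fixes S :: "(real \<times> real) set"
  assumes "\<And>p q :: int. p \<noteq> 0 \<Longrightarrow> q \<noteq> 0 \<Longrightarrow> odd (p + q) \<Longrightarrow> sgn (of_int q, of_int p) \<in> S"
  shows "sphere 0 1 \<subseteq> closure S"
proof
  fix v :: "real \<times> real" assume v: "v \<in> sphere 0 1"
  obtain a b where ab: "v = (a, b)" by (cases v)
  obtain r where r: "even r" "\<And>k. double_floor r a k \<noteq> 0" using double_floor_nonzero by blast
  define w :: "nat \<Rightarrow> real \<times> real" where "w k = (of_int (double_floor r a k), of_int (double_floor 1 b k))" for k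
  have "(\<lambda>k. (of_int (double_floor r a k) / (2 * of_nat k), of_int (double_floor 1 b k) / (2 * of_nat k))) \<longlonglongrightarrow> v"
    unfolding ab by (intro tendsto_Pair double_floor_tendsto)
  then have "(\<lambda>k. (1 / (2 * of_nat k)) *\<^sub>R w k) \<longlonglongrightarrow> v" by (simp add: w_def)
  then have "(\<lambda>k. sgn ((1 / (2 * of_nat k)) *\<^sub>R w k)) \<longlonglongrightarrow> sgn v"
    using v by (intro tendsto_sgn) auto
  moreover have "\<forall>\<^sub>F k in sequentially. sgn ((1 / (2 * of_nat k)) *\<^sub>R w k) = sgn (w k)"
    using eventually_gt_at_top[of 0] by eventually_elim (simp add: sgn_scaleR)
  ultimately have "(\<lambda>k. sgn (w k)) \<longlonglongrightarrow> sgn v" by (rule Lim_transform_eventually)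
  moreover have "sgn v = v" using v by (simp add: sgn_div_norm)
  moreover have "sgn (w k) \<in> S" for k
    unfolding w_def
  proof (rule assms)
    show "double_floor 1 b k \<noteq> 0" by (simp add: double_floor_def) presburger
    show "odd (double_floor 1 b k + double_floor r a k)" using r(1) by (simp add: double_floor_def)
  qed (rule r(2))
  ultimately show "v \<in> closure S"
    unfolding closure_sequential by metis
qed

theorem theorem3:
  fixes \<mu> :: "(int \<Rightarrow> bool) measure"
  assumes "prob_space \<mu>"
    and "sets \<mu> = sets borel"
    and "shift_invariant \<mu>"
    and "shift_ergodic \<mu>"
    and "period_two \<in> measure_support \<mu>"
  shows "AE s in \<mu>. closure (purely_periodic_directions s) = sphere 0 1"
  using AE_alternating[OF assms(1,2,4,5)]
proof eventually_elim
  case (elim s)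
  have "sphere 0 1 \<subseteq> closure (purely_periodic_directions s)"
    using elim by (intro sphere_subset_closure rational_direction_purely_periodic) auto
  moreover have "closure (purely_periodic_directions s) \<subseteq> sphere 0 1"
    by (rule closure_minimal) (auto simp: purely_periodic_directions_def)
  ultimately show ?case by blast
qed

end
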